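(* Let $n\ge1$, let $B\subset\mathbb{R}^n$ be the ball with radius $R$ centered at zero, and let $W$ be a positive radial $C^1$ function on $B\setminus\{0\}$. Assume $a\le\frac{n-2}{2}$. The following two statements are equivalent: (1) $W$ is a Bessel potential on $(0,R)$. (2) There exists $c>0$ such that the following inequality, denoted $(\mathrm{H}_{a,cW})$, holds for all $u\in C_0^\infty(B)$: $$\int_B|x|^{-2a}|\nabla u(x)|^2dx\ge\Big(\frac{n-2a-2}{2}\Big)^2\int_B|x|^{-2a-2}u^2dx+c\int_B|x|^{-2a}W(x)u^2dx .$$ Moreover, $\big(\frac{n-2a-2}{2}\big)^2$ is the best constant and $\beta(W;R)=\sup\{c:\ (\mathrm{H}_{a,cW})\text{ holds}\}$. On the other hand, there is no strictly positive $W\in C^1(0,\infty)$ and no $c>0$ such that the following inequality holds for all $u\in C_0^\infty(\mathbb{R}^n)$: $$\int_{\mathbb{R}^n}|x|^{-2a}|\nabla u(x)|^2dx\ge\Big(\frac{n-2a-2}{2}\Big)^2\int_{\mathbb{R}^n}|x|^{-2a-2}u^2dx+c\int_{\mathbb{R}^n}W(|x|)u^2dx .$$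
   Context: A non-negative $C^1$ function $W$ on $(0,R)$ is a Bessel potential on $(0,R)$ if there is $c>0$ such that $y''+\frac1r y'+cW(r)y=0$ has a positive solution on $(0,R)$; its weight $\beta(W;R)$ is the supremum of all such $c$. One writes $W(x)=W(|x|)$. A constant is best if it cannot be replaced by a larger one. *)

theory Defs
  imports "HOL-Analysis.Analysis"
begin

definition has_positive_bessel_solution :: "(real \<Rightarrow> real) \<Rightarrow> real \<Rightarrow> real \<Rightarrow> bool" where
  "has_positive_bessel_solution W R c \<longleftrightarrow>
     (\<exists>y y' y'' :: real \<Rightarrow> real. \<forall>r\<in>{0<..<R}.
        0 < y r \<and>
        (y has_real_derivative y' r) (at r) \<and>
        (y' has_real_derivative y'' r) (at r) \<and>
        y'' r + 1 / r * y' r + c * W r * y r = 0)"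

definition bessel_potential :: "(real \<Rightarrow> real) \<Rightarrow> real \<Rightarrow> bool" where
  "bessel_potential W R \<longleftrightarrow>
     W C1_differentiable_on {0<..<R} \<and> (\<forall>r\<in>{0<..<R}. 0 \<le> W r) \<and>
     (\<exists>c>0. has_positive_bessel_solution W R c)"

text \<open>The supremum is taken in the extended reals, so that it is a genuine supremum even
  if the set is unbounded (as for \<open>W = 0\<close>).\<close>

definition bessel_weight :: "(real \<Rightarrow> real) \<Rightarrow> real \<Rightarrow> ereal" where
  "bessel_weight W R = Sup (ereal ` {c. 0 < c \<and> has_positive_bessel_solution W R c})"

text \<open>Continuous partial derivatives of all orders up to \<open>k\<close>, on the whole space.\<close>

primrec C_k :: "nat \<Rightarrow> (real ^ 'n \<Rightarrow> real) \<Rightarrow> bool" where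
  "C_k 0 u \<longleftrightarrow> continuous_on UNIV u"
| "C_k (Suc k) u \<longleftrightarrow>
     u differentiable_on UNIV \<and> (\<forall>i. C_k k (\<lambda>x. frechet_derivative u (at x) (axis i 1)))"

text \<open>Elements of \<open>C\<^sub>0\<^sup>\<infinity>(\<Omega>)\<close> are represented by their extension by zero to the whole space.\<close>

definition test_functions :: "(real ^ 'n) set \<Rightarrow> (real ^ 'n \<Rightarrow> real) set" where
  "test_functions \<Omega> =
     {u. (\<forall>k. C_k k u) \<and> compact (closure {x. u x \<noteq> 0}) \<and> closure {x. u x \<noteq> 0} \<subseteq> \<Omega>}"

definition grad :: "(real ^ 'n \<Rightarrow> real) \<Rightarrow> real ^ 'n \<Rightarrow> real ^ 'n" where
  "grad u x = (\<chi> i. frechet_derivative u (at x) (axis i 1))"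

text \<open>The integrands are non-negative almost everywhere when \<open>V\<close> is, and the integrals are
  taken in \<open>[0, \<infinity>]\<close>; in particular the inequality fails if a term on the right diverges while
  the left-hand side is finite. The convention \<open>0 * \<infinity> = 0\<close> matters only for \<open>K = 0\<close>, where it
  makes the Hardy term disappear (for \<open>a = (n - 2) / 2\<close> its integral diverges if
  \<open>u 0 \<noteq> 0\<close>).\<close>

definition hardy_inequality ::
  "(real ^ 'n) set \<Rightarrow> real \<Rightarrow> real \<Rightarrow> real \<Rightarrow> (real ^ 'n \<Rightarrow> real) \<Rightarrow> bool" where
  "hardy_inequality \<Omega> a K c V \<longleftrightarrow>
     (\<forall>u\<in>test_functions \<Omega>.
        (\<integral>\<^sup>+x\<in>\<Omega>. ennreal (norm x powr (- 2 * a) * (norm (grad u x))\<^sup>2) \<partial>lborel) \<ge>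
          ennreal K * (\<integral>\<^sup>+x\<in>\<Omega>. ennreal (norm x powr (- 2 * a - 2) * (u x)\<^sup>2) \<partial>lborel)
        + ennreal c * (\<integral>\<^sup>+x\<in>\<Omega>. ennreal (V x * (u x)\<^sup>2) \<partial>lborel))"

definition best_constant :: "(real \<Rightarrow> bool) \<Rightarrow> real \<Rightarrow> bool" where
  "best_constant P K \<longleftrightarrow> P K \<and> (\<forall>K'>K. \<not> P K')"

end

theory Submission
  imports Defs
begin

text \<open>
  Let \<open>m = n - 2a - 2 \<ge> 0\<close>. The substitution \<open>u = |x| powr (- m / 2) * g\<close> absorbs the Hardy
  term, so that for radial functions the inequality becomes \<open>\<integral> r g'\<^sup>2 dr \<ge> c \<integral> r W g\<^sup>2 dr\<close>. Its
  validity for compactly supported \<open>g\<close> bounds every solution of the Riccati inequality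
  \<open>p' \<le> c r W + p\<^sup>2 / r\<close> starting from \<open>0\<close> by \<open>p s \<le> 1 / ln (b / s)\<close> for \<open>s < b < R\<close>. Hence a monotone
  iteration converges to a solution of \<open>p' = c r W + p\<^sup>2 / r\<close> on the whole of \<open>(0, R)\<close>, and
  \<open>y = exp (- \<integral> p / r)\<close> solves the Bessel equation with the same \<open>c\<close>. The same bound with
  \<open>p\<close> an integral of the weight gives the optimality of the Hardy constant (the weight gains a
  term \<open>\<epsilon> / r\<close>, whose integral diverges at \<open>0\<close>) and the nonexistence on the whole space
  (let \<open>b \<rightarrow> \<infinity>\<close>).

  Conversely, a positive solution \<open>y\<close> is nonincreasing, and \<open>\<phi> = r powr (- m / 2) * y\<close> has a
  nonpositive logarithmic derivative. Integrating the divergence of \<open>|x| powr (- 2a) * (\<phi>' / \<phi>) * u\<^sup>2 * x / |x|\<close>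
  and completing the square gives the inequality with the same \<open>c\<close>; the boundary term at the
  origin has the right sign, so \<open>u\<close> need not vanish there.
\<close>

section \<open>Smooth radial test functions\<close>

text \<open>After the substitution the energy is that of a radial function in the plane, where a
  point has capacity zero. Two things follow. Competitors can be made to vanish near the origin at
  arbitrarily small cost, so in passing from the inequality to a solution only functions supported
  in annuli are tested, and every integral is finite. And the least energy for falling from 1 to 0
  between s and b is 1 / ln (b / s), the capacity of that annulus, which is where the Riccati bound
  comes from. The obstacle is that the Riccati equation cannot simply be started at 0: its weight
  may be singular there, and integrability near 0 has to come out of the inequality. Hence the a
  priori bound must be uniform in the starting point. The profile that proves this bound is only
  piecewise smooth, while the inequality is given for smooth functions on the whole space;
  polynomials times a radial bump bridge the gap. No step changes c, so the equivalence holds for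
  each c separately, and the two suprema in the theorem are taken over the same set.\<close>

definition flat_exp :: "nat \<Rightarrow> real \<Rightarrow> real" where
  "flat_exp k t = (if 0 < t then exp (- inverse t) / t ^ k else 0)"

text \<open>This is the difference quotient of \<open>flat_exp k\<close> at 0, so it gives
  differentiability there. On the right, x = 1 / t turns it into x ^ (k + 1) / exp x.\<close>

lemma flat_exp_over_tendsto_0: "((\<lambda>t. flat_exp k t / t) \<longlongrightarrow> 0) (at 0)"
proof -
  have "((\<lambda>x::real. x ^ Suc k / exp x) \<longlongrightarrow> 0) at_top"
    by (rule tendsto_power_div_exp_0)
  then have "((\<lambda>t::real. inverse t ^ Suc k / exp (inverse t)) \<longlongrightarrow> 0) (at_right 0)"
    by (rule filterlim_compose) (rule filterlim_inverse_at_top_right)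
  then have r: "((\<lambda>t. flat_exp k t / t) \<longlongrightarrow> 0) (at_right 0)"
    by (rule Lim_transform_eventually)
      (auto simp: eventually_at_filter flat_exp_def exp_minus field_simps)
  have l: "((\<lambda>t. flat_exp k t / t) \<longlongrightarrow> 0) (at_left 0)"
    by (rule tendsto_eventually) (auto simp: eventually_at_filter flat_exp_def)
  show ?thesis using l r by (simp add: filterlim_split_at)
qed

text \<open>The power of t is built into \<open>flat_exp\<close> so that the family is closed under
  differentiation up to linear combinations; k = 0 is the classical smooth function exp (- 1 /
  t).\<close>

lemma flat_exp_has_derivative:
  "(flat_exp k has_real_derivative flat_exp (k + 2) t - real k * flat_exp (k + 1) t) (at t)"
proof (cases t "0::real" rule: linorder_cases)
  case less
  have "((\<lambda>_. 0::real) has_real_derivative 0) (at t)" by simp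
  then have "(flat_exp k has_real_derivative 0) (at t)"
    by (rule DERIV_cong_ev[THEN iffD1, rotated 3])
      (use less in \<open>auto simp: flat_exp_def eventually_nhds intro!: exI[of _ "{..<0}"]\<close>)
  then show ?thesis using less by (simp add: flat_exp_def)
next
  case equal
  show ?thesis using flat_exp_over_tendsto_0[of k] equal
    by (simp add: has_field_derivative_iff flat_exp_def)
next
  case greater
  have "((\<lambda>t. exp (- inverse t) / t ^ k) has_real_derivative
      flat_exp (k + 2) t - real k * flat_exp (k + 1) t) (at t)"
    using greater
    by (auto intro!: derivative_eq_intros simp: flat_exp_def field_simps power2_eq_square)
      (cases k; simp add: field_simps)
  then show ?thesis
    by (rule DERIV_cong_ev[THEN iffD1, rotated 3])
      (use greater in \<open>auto simp: flat_exp_def eventually_nhds intro!: exI[of _ "{0<..}"]\<close>)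
qed

text \<open>An algebra of functions that is closed under partial derivatives and contains
  radial bump functions.\<close>

inductive elementary :: "(real ^ 'n \<Rightarrow> real) \<Rightarrow> bool" where
  const: "elementary (\<lambda>x. c)"
| coord: "elementary (\<lambda>x. x $ i)"
| flat: "elementary (\<lambda>x. flat_exp k (c * (norm x)\<^sup>2 + d))"
| add: "elementary f \<Longrightarrow> elementary g \<Longrightarrow> elementary (\<lambda>x. f x + g x)"
| mult: "elementary f \<Longrightarrow> elementary g \<Longrightarrow> elementary (\<lambda>x. f x * g x)"

lemma elementary_diff: "elementary f \<Longrightarrow> elementary g \<Longrightarrow> elementary (\<lambda>x. f x - g x)"
  using elementary.add[OF _ elementary.mult[OF elementary.const[of "-1"]], of f g] by simp

lemma elementary_norm_square: "elementary (\<lambda>x :: real ^ 'n. (norm x)\<^sup>2)"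
proof -
  have sum: "elementary (\<lambda>x. \<Sum>i\<in>I. x $ i * x $ i)" if "finite I" for I :: "'n set"
    using that
  proof (induction I)
    case empty
    show ?case using elementary.const[of 0] by simp
  next
    case (insert i I)
    then show ?case
      using elementary.add[OF elementary.mult[OF elementary.coord[of i] elementary.coord[of i]]] by simp
  qed
  show ?thesis using sum[of UNIV]
    by (simp add: power2_norm_eq_inner inner_vec_def)
qed

lemma elementary_polynomial:
  "real_polynomial_function P \<Longrightarrow> elementary (\<lambda>x. P ((norm x)\<^sup>2))"
proof (induction P rule: real_polynomial_function.induct)
  case (linear f)
  then obtain c where "f = (\<lambda>x. x * c)" using real_bounded_linear by auto
  then show ?case by (auto intro: elementary.intros elementary_norm_square)
qed (auto intro: elementary.intros)

text \<open>The direction is the first argument of \<open>D\<close>: then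
  \<open>D (axis i 1)\<close> is a partial derivative as a function of the point, and the result
  applies to it again in the induction on the order.\<close>

lemma elementary_has_derivative:
  assumes "elementary f"
  shows "\<exists>D. (\<forall>x. (f has_derivative (\<lambda>h. D h x)) (at x)) \<and> (\<forall>i. elementary (D (axis i 1)))"
  using assms
proof (induction rule: elementary.induct)
  case (const c)
  show ?case by (intro exI[of _ "\<lambda>_ _. 0"]) (auto intro: elementary.intros)
next
  case (coord i)
  have "elementary (\<lambda>x. axis j 1 $ i)" for j :: 'a by (rule elementary.const)
  then show ?case
    by (intro exI[of _ "\<lambda>h x. h $ i"]) (auto intro!: derivative_eq_intros bounded_linear_imp_has_derivative bounded_linear_vec_nth)
next
  case (flat k c d)
  let ?E = "\<lambda>x. flat_exp (k + 2) (c * (norm x)\<^sup>2 + d) - real k * flat_exp (k + 1) (c * (norm x)\<^sup>2 + d)"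
  let ?D = "\<lambda>h x. ?E x * (c * (2 * (x \<bullet> h)))"
  have D1: "((\<lambda>x. flat_exp k (c * (norm x)\<^sup>2 + d)) has_derivative (\<lambda>h. ?D h x)) (at x)" for x :: "real ^ 'a"
  proof -
    have "((\<lambda>x. c * (norm x)\<^sup>2 + d) has_derivative (\<lambda>h. c * (2 * (x \<bullet> h)))) (at x)"
      unfolding power2_norm_eq_inner
      by (auto intro!: derivative_eq_intros simp: inner_commute)
    from has_derivative_compose[OF this flat_exp_has_derivative[THEN has_field_derivative_imp_has_derivative]]
    show ?thesis .
  qed
  have D2: "elementary (?D (axis i 1))" for i :: 'a
    by (auto simp: inner_axis intro!: elementary.intros elementary_diff)
  show ?case by (intro exI[of _ ?D] conjI allI D1 D2)
next
  case (add f g)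
  then obtain D E where "\<forall>x. (f has_derivative (\<lambda>h. D h x)) (at x)" "\<forall>i. elementary (D (axis i 1))"
    "\<forall>x. (g has_derivative (\<lambda>h. E h x)) (at x)" "\<forall>i. elementary (E (axis i 1))" by auto
  then show ?case
    by (intro exI[of _ "\<lambda>h x. D h x + E h x"]) (auto intro: elementary.intros has_derivative_add)
next
  case (mult f g)
  then obtain D E where "\<forall>x. (f has_derivative (\<lambda>h. D h x)) (at x)" "\<forall>i. elementary (D (axis i 1))"
    "\<forall>x. (g has_derivative (\<lambda>h. E h x)) (at x)" "\<forall>i. elementary (E (axis i 1))" by auto
  then show ?case using mult.hyps
    by (intro exI[of _ "\<lambda>h x. f x * E h x + D h x * g x"])
      (auto intro!: elementary.intros has_derivative_mult)
qed

lemma elementary_C_k: "elementary f \<Longrightarrow> C_k k f"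
proof (induction k arbitrary: f)
  case 0
  then obtain D where "\<And>x. (f has_derivative (\<lambda>h. D h x)) (at x)"
    using elementary_has_derivative[OF 0] by blast
  then have "isCont f x" for x by (rule has_derivative_continuous)
  then show ?case by (simp add: continuous_at_imp_continuous_on)
next
  case (Suc k)
  obtain D where D: "\<And>x. (f has_derivative (\<lambda>h. D h x)) (at x)" "\<And>i. elementary (D (axis i 1))"
    using elementary_has_derivative[OF Suc.prems] by blast
  have "frechet_derivative f (at x) = (\<lambda>h. D h x)" for x
    using frechet_derivative_at[OF D(1)] by simp
  moreover have "f differentiable at x" for x
    using D(1) by (rule differentiableI)
  ultimately show ?case
    by (simp add: differentiable_on_def differentiable_at_withinI Suc.IH[OF D(2)])
qed

section \<open>Integration of radial functions\<close>

text \<open>Only the radial part of polar coordinates is needed; the distribution of the norm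
  under Lebesgue measure is determined by the volumes of balls.\<close>

definition sphere_area :: "nat \<Rightarrow> real" where
  "sphere_area n = real n * unit_ball_vol (real n)"

lemma sphere_area_pos: "0 < n \<Longrightarrow> 0 < sphere_area n"
  by (simp add: sphere_area_def)

lemma distr_norm_lborel:
  "distr (lborel :: 'a::euclidean_space measure) borel norm =
    density lborel (\<lambda>r. ennreal (indicator {0..} r * sphere_area DIM('a) * r ^ (DIM('a) - 1)))"
    (is "?M = ?N")
proof (rule measure_eqI_generator_eq[where E = "range (\<lambda>r::real. {..r})" and \<Omega> = UNIV and A = "\<lambda>i. {..real i}"])
  show "Int_stable (range (\<lambda>r::real. {..r}))"
    by (auto simp: Int_stable_def)
  show "sets ?M = sigma_sets UNIV (range (\<lambda>r::real. {..r}))"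
    by (simp add: borel_eq_atMost)
  show "sets ?N = sigma_sets UNIV (range (\<lambda>r::real. {..r}))"
    by (simp add: borel_eq_atMost)
  show "(\<Union>i. {..real i}) = UNIV"
    by (auto simp: real_arch_simple)
  have M: "emeasure ?M {..r} = emeasure (lborel :: 'a measure) (cball 0 r)" for r
    by (subst emeasure_distr) (auto intro!: arg_cong2[of _ _ _ _ emeasure] simp: cball_def)
  then show "emeasure ?M {..real i} \<noteq> \<infinity>" for i
    using emeasure_lborel_cball_finite[of "0 :: 'a" "real i"] by simp
  fix X :: "real set"
  assume "X \<in> range (\<lambda>r::real. {..r})"
  then obtain r where X: "X = {..r}" by auto
  show "emeasure ?M X = emeasure ?N X"
  proof (cases "0 \<le> r")
    case True
    let ?d = "DIM('a)"
    have "emeasure ?N {..r} = (\<integral>\<^sup>+x. ennreal (sphere_area ?d * x ^ (?d - 1)) * indicator {0..r} x \<partial>lborel)"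
      by (subst emeasure_density) (auto intro!: nn_integral_cong simp: indicator_def)
    also have "\<dots> = unit_ball_vol ?d * r ^ ?d - unit_ball_vol ?d * 0 ^ ?d"
      by (rule nn_integral_FTC_Icc)
        (use True in \<open>auto intro!: derivative_eq_intros simp: sphere_area_def\<close>)
    also have "\<dots> = emeasure (lborel :: 'a measure) (cball 0 r)"
      using True by (simp add: emeasure_cball)
    finally show ?thesis using X M by simp
  next
    case False
    then have "emeasure ?N {..r} = (\<integral>\<^sup>+x. 0 \<partial>(lborel :: real measure))"
      by (subst emeasure_density, simp, simp, intro nn_integral_cong) (auto simp: indicator_def)
    then show ?thesis using False X M by (simp add: cball_eq_empty)
  qed
qed auto

text \<open>The shell keeps away from the origin, where the weights may be singular, so a continuous
  profile has a finite integral and the result can be stated with a real one.\<close>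

lemma nn_integral_radial:
  fixes F :: "real \<Rightarrow> real"
  assumes ab: "0 < a" and cont: "continuous_on {a..b} F"
    and nonneg: "\<And>r. r \<in> {a..b} \<Longrightarrow> 0 \<le> F r"
  shows "(\<integral>\<^sup>+x. ennreal (indicator {a..b} (norm x) * F (norm x)) \<partial>(lborel :: 'a::euclidean_space measure)) =
    ennreal (sphere_area DIM('a) * integral {a..b} (\<lambda>r. r ^ (DIM('a) - 1) * F r))"
proof -
  let ?d = "DIM('a)"
  let ?G = "\<lambda>r. indicator {a..b} r * F r"
  have [measurable]: "?G \<in> borel_measurable borel"
    using borel_measurable_continuous_on_indicator[OF _ cont] by simp
  have "(\<integral>\<^sup>+x. ennreal (?G (norm x)) \<partial>(lborel :: 'a measure)) = (\<integral>\<^sup>+r. ennreal (?G r) \<partial>distr (lborel :: 'a measure) borel norm)"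
    by (subst nn_integral_distr) auto
  also have "\<dots> = (\<integral>\<^sup>+r. ennreal (indicator {0..} r * sphere_area ?d * r ^ (?d - 1)) * ennreal (?G r) \<partial>lborel)"
    unfolding distr_norm_lborel by (subst nn_integral_density) auto
  also have "\<dots> = (\<integral>\<^sup>+r. ennreal (sphere_area ?d * (indicator {a..b} r * (r ^ (?d - 1) * F r))) \<partial>lborel)"
    using ab nonneg sphere_area_pos[of ?d]
    by (intro nn_integral_cong) (auto simp: indicator_def ennreal_mult'[symmetric] mult_ac)
  also have "\<dots> = ennreal (sphere_area ?d * integral {a..b} (\<lambda>r. r ^ (?d - 1) * F r))"
  proof (rule nn_integral_has_integral_lborel)
    have c: "continuous_on {a..b} (\<lambda>r. r ^ (?d - 1) * F r)"
      by (intro continuous_intros cont)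
    then show "(\<lambda>r. sphere_area ?d * (indicator {a..b} r * (r ^ (?d - 1) * F r))) \<in> borel_measurable borel"
      using borel_measurable_continuous_on_indicator[OF _ c] by simp
    show "0 \<le> sphere_area ?d * (indicator {a..b} r * (r ^ (?d - 1) * F r))" for r
      using ab nonneg sphere_area_pos[of ?d] by (auto simp: indicator_def)
    have "((\<lambda>r. r ^ (?d - 1) * F r) has_integral integral {a..b} (\<lambda>r. r ^ (?d - 1) * F r)) {a..b}"
      using integrable_continuous_real[OF c] by (simp add: integrable_integral)
    then have "((\<lambda>r. indicator {a..b} r * (r ^ (?d - 1) * F r)) has_integral integral {a..b} (\<lambda>r. r ^ (?d - 1) * F r)) UNIV"
      by (subst (asm) has_integral_restrict_UNIV[symmetric])
        (auto elim!: has_integral_eq[rotated] simp: indicator_def)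
    then show "((\<lambda>r. sphere_area ?d * (indicator {a..b} r * (r ^ (?d - 1) * F r))) has_integral
        sphere_area ?d * integral {a..b} (\<lambda>r. r ^ (?d - 1) * F r)) UNIV"
      by (rule has_integral_mult_right)
  qed
  finally show ?thesis .
qed

section \<open>Approximation by test functions\<close>

text \<open>Written in the square of r so that composition with the norm is a product of two
  generators of \<open>elementary\<close>, hence smooth.\<close>

definition bump :: "real \<Rightarrow> real \<Rightarrow> real \<Rightarrow> real" where
  "bump \<alpha> \<beta> r = flat_exp 0 (r\<^sup>2 - \<alpha>\<^sup>2) * flat_exp 0 (\<beta>\<^sup>2 - r\<^sup>2)"

definition bump' :: "real \<Rightarrow> real \<Rightarrow> real \<Rightarrow> real" where
  "bump' \<alpha> \<beta> r = 2 * r * (flat_exp 2 (r\<^sup>2 - \<alpha>\<^sup>2) * flat_exp 0 (\<beta>\<^sup>2 - r\<^sup>2)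
     - flat_exp 0 (r\<^sup>2 - \<alpha>\<^sup>2) * flat_exp 2 (\<beta>\<^sup>2 - r\<^sup>2))"

lemma isCont_flat_exp: "isCont (flat_exp k) t"
  using flat_exp_has_derivative by (rule DERIV_isCont)

lemma bump_has_derivative: "(bump \<alpha> \<beta> has_real_derivative bump' \<alpha> \<beta> r) (at r)"
proof -
  have e: "(flat_exp 0 has_real_derivative flat_exp 2 t) (at t)" for t
    using flat_exp_has_derivative[of 0 t] by (simp add: numeral_2_eq_2)
  have 1: "((\<lambda>r. flat_exp 0 (r\<^sup>2 - \<alpha>\<^sup>2)) has_real_derivative flat_exp 2 (r\<^sup>2 - \<alpha>\<^sup>2) * (2 * r)) (at r)"
    by (rule DERIV_chain2[OF e]) (auto intro!: derivative_eq_intros)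
  have 2: "((\<lambda>r. flat_exp 0 (\<beta>\<^sup>2 - r\<^sup>2)) has_real_derivative flat_exp 2 (\<beta>\<^sup>2 - r\<^sup>2) * (- (2 * r))) (at r)"
    by (rule DERIV_chain2[OF e]) (auto intro!: derivative_eq_intros)
  from DERIV_mult[OF 1 2] show ?thesis
    unfolding bump_def[abs_def] bump'_def by (rule DERIV_cong) (simp add: algebra_simps)
qed

lemma continuous_on_bump' [continuous_intros]: "continuous_on A (bump' \<alpha> \<beta>)"
proof -
  have "isCont (bump' \<alpha> \<beta>) r" for r
    unfolding bump'_def[abs_def]
    by (intro continuous_intros isCont_o2[OF _ isCont_flat_exp])
  then show ?thesis by (simp add: continuous_at_imp_continuous_on)
qed

lemma bump_nonneg: "0 \<le> bump \<alpha> \<beta> r" and bump_le_1: "bump \<alpha> \<beta> r \<le> 1"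
  by (auto simp: bump_def flat_exp_def mult_le_one)

lemma bump_eq_0_iff: "0 < \<alpha> \<Longrightarrow> \<alpha> < \<beta> \<Longrightarrow> 0 \<le> r \<Longrightarrow> bump \<alpha> \<beta> r = 0 \<longleftrightarrow> r \<le> \<alpha> \<or> \<beta> \<le> r"
  using power2_less_imp_less[of \<alpha> r] power2_less_imp_less[of r \<beta>]
    power_strict_mono[of \<alpha> r 2] power_strict_mono[of r \<beta> 2]
  by (cases "\<alpha> < r"; cases "r < \<beta>") (auto simp: bump_def flat_exp_def)

lemma bump_radial_test_function:
  assumes "0 < \<alpha>" "\<alpha> < \<beta>" "real_polynomial_function P"
    and sub: "{x :: real ^ 'n. \<alpha> \<le> norm x \<and> norm x \<le> \<beta>} \<subseteq> \<Omega>"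
  shows "(\<lambda>x :: real ^ 'n. bump \<alpha> \<beta> (norm x) * P ((norm x)\<^sup>2)) \<in> test_functions \<Omega>"
proof -
  let ?u = "\<lambda>x :: real ^ 'n. bump \<alpha> \<beta> (norm x) * P ((norm x)\<^sup>2)"
  let ?A = "{x :: real ^ 'n. \<alpha> \<le> norm x \<and> norm x \<le> \<beta>}"
  have u: "elementary ?u"
    using elementary.mult[OF elementary.mult[OF elementary.flat[of 0 1 "- \<alpha>\<^sup>2"] elementary.flat[of 0 "-1" "\<beta>\<^sup>2"]]
      elementary_polynomial[OF assms(3)]]
    by (simp add: bump_def)
  have "closed ?A"
    by (intro closed_Collect_conj closed_Collect_le continuous_intros)
  moreover have "{x. ?u x \<noteq> 0} \<subseteq> ?A"
    using bump_eq_0_iff[OF assms(1,2)] by force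
  ultimately have cl: "closure {x. ?u x \<noteq> 0} \<subseteq> ?A" by (intro closure_minimal)
  have "bounded ?A" by (rule boundedI[of _ \<beta>]) auto
  with cl have "compact (closure {x. ?u x \<noteq> 0})"
    by (meson bounded_closed_imp_seq_compact bounded_subset closed_closure compact_eq_bounded_closed)
  with cl show ?thesis using u sub
    by (auto simp: test_functions_def elementary_C_k)
qed

lemma norm_grad_radial:
  fixes x :: "real ^ 'n"
  assumes "x \<noteq> 0" and q: "(q has_real_derivative d) (at (norm x))"
  shows "norm (grad (\<lambda>x. q (norm x)) x) = \<bar>d\<bar>"
proof -
  have "((\<lambda>x. q (norm x)) has_derivative (\<lambda>h. d * (sgn x \<bullet> h))) (at x)"
    using has_derivative_compose[OF has_derivative_norm[OF assms(1)]
      q[THEN has_field_derivative_imp_has_derivative]] by (simp add: inner_commute)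
  then have "frechet_derivative (\<lambda>x. q (norm x)) (at x) = (\<lambda>h. d * (sgn x \<bullet> h))"
    by (rule frechet_derivative_at[symmetric])
  then have "grad (\<lambda>x. q (norm x)) x = d *\<^sub>R sgn x"
    by (simp add: grad_def vec_eq_iff inner_axis)
  then show ?thesis using assms(1) by (simp add: norm_sgn)
qed

lemma real_polynomial_antiderivative:
  assumes "real_polynomial_function p"
  obtains P where "real_polynomial_function P" "\<And>t :: real. (P has_real_derivative p t) (at t)" "P t0 = 0"
proof -
  obtain a n where p: "p = (\<lambda>t. \<Sum>i\<le>n. a i * t ^ i)"
    using assms real_polynomial_function_iff_sum by blast
  define P where "P t = (\<Sum>i\<le>n. a i / real (Suc i) * t ^ Suc i)" for t
  have P: "real_polynomial_function P" unfolding P_def[abs_def]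
    by (intro real_polynomial_function_sum real_polynomial_function_power real_polynomial_function.intros) auto
  have "(P has_real_derivative p t) (at t)" for t
    unfolding P_def[abs_def] p
    by (rule DERIV_sum) (auto intro!: derivative_eq_intros simp del: power_Suc of_nat_Suc)
  then have "((\<lambda>t. P t - P t0) has_real_derivative p t) (at t)" for t
    by (auto intro!: derivative_eq_intros)
  then show ?thesis
    using that[of "\<lambda>t. P t - P t0"] real_polynomial_function_diff[OF P real_polynomial_function.intros(2)] by simp
qed

text \<open>Weierstrass approximation of the derivative of \<open>f / bump\<close> in the variable \<open>r\<^sup>2\<close>.\<close>

lemma C1_approximation_by_bump:
  fixes f f' :: "real \<Rightarrow> real"
  assumes \<alpha>\<beta>: "0 < \<alpha>" "\<alpha> < \<alpha>1" "\<beta>1 < \<beta>" "\<alpha> < \<beta>"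
    and f: "\<And>r. 0 < r \<Longrightarrow> (f has_real_derivative f' r) (at r)"
    and f': "continuous_on {0<..} f'"
    and zero: "\<And>r. r \<notin> {\<alpha>1..\<beta>1} \<Longrightarrow> f r = 0"
    and \<epsilon>: "0 < \<epsilon>"
  obtains q q' P where "real_polynomial_function P" "q = (\<lambda>r. bump \<alpha> \<beta> r * P (r\<^sup>2))"
    "\<And>r. (q has_real_derivative q' r) (at r)" "continuous_on UNIV q'"
    "\<And>r. r \<in> {\<alpha>..\<beta>} \<Longrightarrow> \<bar>q r - f r\<bar> \<le> \<epsilon> \<and> \<bar>q' r - f' r\<bar> \<le> \<epsilon>"
proof -
  let ?b = "bump \<alpha> \<beta>" and ?b' = "bump' \<alpha> \<beta>"
  have f'_zero: "f' r = 0" if "0 < r" "r \<notin> {\<alpha>1..\<beta>1}" for r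
  proof -
    have "((\<lambda>_. 0) has_real_derivative f' r) (at r)"
    proof (rule has_field_derivative_transform_within_open[OF f[OF that(1)]])
      show "open (- {\<alpha>1..\<beta>1})" by (simp add: open_Compl)
    qed (use that zero in auto)
    then show ?thesis using DERIV_unique[OF DERIV_const] by metis
  qed
  have b_pos: "?b r \<noteq> 0" if "\<alpha> < r" "r < \<beta>" for r
    using that \<alpha>\<beta> bump_eq_0_iff[of \<alpha> \<beta> r] by auto
  \<comment> \<open>\<open>f\<close> vanishes off {\<alpha>1..\<beta>1}, and \<open>bump\<close> is
    nonzero between \<alpha> and \<beta>, a strictly larger range. So the quotient is C1 for r > 0,
    where division by zero gives the right value 0 outside.\<close>
  define F where "F r = f r / ?b r" for r
  define F' where "F' r = (f' r * ?b r - f r * ?b' r) / (?b r * ?b r)" for r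
  have F: "(F has_real_derivative F' r) (at r)" if "0 < r" for r
  proof (cases "\<alpha> < r \<and> r < \<beta>")
    case True
    show ?thesis unfolding F_def[abs_def] F'_def
      by (rule DERIV_divide[OF f bump_has_derivative]) (use b_pos True that in auto)
  next
    case False
    have "F' r = 0" unfolding F'_def using bump_eq_0_iff[of \<alpha> \<beta> r] False \<alpha>\<beta> that by auto
    moreover have "((\<lambda>_. 0) has_real_derivative 0) (at r)" by simp
    then have "(F has_real_derivative 0) (at r)"
    proof (rule has_field_derivative_transform_within_open)
      show "open (- {\<alpha>1..\<beta>1})" by (simp add: open_Compl)
    qed (use False \<alpha>\<beta> zero F_def in auto)
    ultimately show ?thesis by simp
  qed
  have F'_cont: "continuous_on {0<..} F'"
  proof -
    have eq: "{0<..} = {\<alpha><..<\<beta>} \<union> ({0<..} - {\<alpha>1..\<beta>1})" using \<alpha>\<beta> by auto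
    have "continuous_on {\<alpha><..<\<beta>} F'" unfolding F'_def
      using b_pos \<alpha>\<beta> DERIV_isCont[OF bump_has_derivative[of \<alpha> \<beta>]] DERIV_isCont[OF f]
      by (intro continuous_intros continuous_on_subset[OF f'])
        (auto intro!: continuous_at_imp_continuous_on)
    moreover have "continuous_on ({0<..} - {\<alpha>1..\<beta>1}) F'"
      by (rule continuous_on_eq[of _ "\<lambda>_. 0"]) (auto simp: F'_def f'_zero zero)
    ultimately show ?thesis
      by (subst eq) (intro continuous_on_open_Un, auto)
  qed
  \<comment> \<open>The variable is t = r ^ 2 because polynomials in the squared norm belong to
    \<open>elementary\<close>.\<close>
  define Q where "Q t = F (sqrt t)" for t
  define Q' where "Q' t = F' (sqrt t) / (2 * sqrt t)" for t
  have Q: "(Q has_real_derivative Q' t) (at t)" if "0 < t" for t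
    unfolding Q_def[abs_def] Q'_def
    using DERIV_chain2[OF F DERIV_real_sqrt[OF that]] that by (simp add: field_simps)
  have sub: "t \<in> {\<alpha>\<^sup>2..\<beta>\<^sup>2} \<Longrightarrow> 0 < t" for t
    using \<alpha>\<beta>(1) by (auto intro: less_le_trans[of 0 "\<alpha>\<^sup>2"])
  have Q'_cont: "continuous_on {\<alpha>\<^sup>2..\<beta>\<^sup>2} Q'" unfolding Q'_def
    by (intro continuous_intros continuous_on_compose2[OF F'_cont]) (use sub in force)+
  have "bounded (?b' ` {\<alpha>..\<beta>})"
    by (intro compact_imp_bounded compact_continuous_image continuous_intros compact_Icc)
  then obtain M where M: "0 < M" "\<And>r. r \<in> {\<alpha>..\<beta>} \<Longrightarrow> \<bar>?b' r\<bar> \<le> M"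
    unfolding bounded_pos by auto
  define L where "L = \<beta>\<^sup>2 - \<alpha>\<^sup>2"
  have L: "0 < L" unfolding L_def using \<alpha>\<beta> by (simp add: power_strict_mono)
  \<comment> \<open>From |p - Q'| < e follows |P - Q| <= e * L, so the errors of \<open>q\<close>
    and \<open>q'\<close> are at most e * L and M * e * L + 2 * \<beta> * e. The denominator
    dominates both factors of e.\<close>
  define e where "e = \<epsilon> / (1 + (1 + M) * L + 2 * \<beta>)"
  have den: "0 < 1 + (1 + M) * L + 2 * \<beta>" using M(1) L \<alpha>\<beta> by (intro add_pos_pos mult_pos_pos) auto
  then have e: "0 < e" using \<epsilon> by (simp add: e_def)
  obtain p where p: "real_polynomial_function p" "\<And>t. t \<in> {\<alpha>\<^sup>2..\<beta>\<^sup>2} \<Longrightarrow> \<bar>Q' t - p t\<bar> < e"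
    using Stone_Weierstrass_real_polynomial_function[OF compact_Icc Q'_cont e] by blast
  obtain P where P: "real_polynomial_function P" "\<And>t. (P has_real_derivative p t) (at t)" "P (\<alpha>\<^sup>2) = 0"
    using real_polynomial_antiderivative[OF p(1)] by blast
  have Q0: "Q (\<alpha>\<^sup>2) = 0" using \<alpha>\<beta> zero[of \<alpha>] by (simp add: Q_def F_def)
  have PQ: "\<bar>P t - Q t\<bar> \<le> e * L" if "t \<in> {\<alpha>\<^sup>2..\<beta>\<^sup>2}" for t
  proof -
    have "norm ((P t - Q t) - (P (\<alpha>\<^sup>2) - Q (\<alpha>\<^sup>2))) \<le> e * norm (t - \<alpha>\<^sup>2)"
    proof (rule field_differentiable_bound[of "{\<alpha>\<^sup>2..\<beta>\<^sup>2}" "\<lambda>t. P t - Q t" "\<lambda>t. p t - Q' t"])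
      show "((\<lambda>t. P t - Q t) has_real_derivative p z - Q' z) (at z within {\<alpha>\<^sup>2..\<beta>\<^sup>2})"
        if "z \<in> {\<alpha>\<^sup>2..\<beta>\<^sup>2}" for z
        using DERIV_diff[OF P(2) Q[OF sub[OF that]]] by (rule has_field_derivative_at_within)
      show "norm (p z - Q' z) \<le> e" if "z \<in> {\<alpha>\<^sup>2..\<beta>\<^sup>2}" for z
        using p(2)[OF that] by (simp add: abs_minus_commute)
    qed (use that in auto)
    also have "\<dots> \<le> e * L" using that e by (intro mult_left_mono) (auto simp: L_def)
    finally show ?thesis using Q0 P(3) by simp
  qed
  define q where "q r = ?b r * P (r\<^sup>2)" for r
  define q' where "q' r = ?b' r * P (r\<^sup>2) + ?b r * (p (r\<^sup>2) * (2 * r))" for r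
  show thesis
  proof
    show "real_polynomial_function P" by fact
    show "q = (\<lambda>r. ?b r * P (r\<^sup>2))" by (simp add: q_def[abs_def])
    have "((\<lambda>r. P (r\<^sup>2)) has_real_derivative p (r\<^sup>2) * (2 * r)) (at r)" for r
      by (rule DERIV_chain2[OF P(2)]) (auto intro!: derivative_eq_intros)
    from DERIV_mult[OF bump_has_derivative this]
    show "(q has_real_derivative q' r) (at r)" for r
      unfolding q_def[abs_def] q'_def by (rule DERIV_cong) (simp add: algebra_simps)
    have poly: "continuous_on UNIV (\<lambda>r :: real. g (r\<^sup>2))" if "real_polynomial_function g" for g
    proof (rule continuous_on_compose2[of UNIV g])
      show "continuous_on UNIV g"
        using that by (simp add: real_polynomial_function_eq continuous_on_polymonial_function)
    qed (auto intro: continuous_intros)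
    have "continuous_on UNIV ?b"
      using DERIV_isCont[OF bump_has_derivative] by (simp add: continuous_at_imp_continuous_on)
    then show "continuous_on UNIV q'"
      unfolding q'_def[abs_def]
      by (intro continuous_on_add continuous_on_mult continuous_on_bump' continuous_on_const
        continuous_on_id poly p(1) P(1))
    fix r assume r: "r \<in> {\<alpha>..\<beta>}"
    then have r2: "r\<^sup>2 \<in> {\<alpha>\<^sup>2..\<beta>\<^sup>2}" "0 < r" using \<alpha>\<beta> by (auto intro: power_mono)
    have fr: "f r = ?b r * Q (r\<^sup>2)"
      using b_pos[of r] zero[of r] r \<alpha>\<beta> r2 by (cases "\<alpha> < r \<and> r < \<beta>") (auto simp: Q_def F_def)
    have f'r: "f' r = ?b' r * Q (r\<^sup>2) + ?b r * (Q' (r\<^sup>2) * (2 * r))"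
    proof (cases "\<alpha> < r \<and> r < \<beta>")
      case True
      then have "?b r \<noteq> 0" by (simp add: b_pos)
      then show ?thesis using r2 by (simp add: Q_def Q'_def F_def F'_def field_simps)
    next
      case False
      then have "f r = 0" "f' r = 0" "?b r = 0"
        using zero[of r] f'_zero[of r] bump_eq_0_iff[of \<alpha> \<beta> r] r2 \<alpha>\<beta> by auto
      then show ?thesis using r2 by (simp add: Q_def F_def)
    qed
    have "\<bar>q r - f r\<bar> = ?b r * \<bar>P (r\<^sup>2) - Q (r\<^sup>2)\<bar>"
      using bump_nonneg[of \<alpha> \<beta> r] unfolding fr q_def
      by (simp add: right_diff_distrib[symmetric] abs_mult)
    also have "\<dots> \<le> 1 * (e * L)"
      using PQ[OF r2(1)] bump_nonneg[of \<alpha> \<beta> r] bump_le_1[of \<alpha> \<beta> r] by (intro mult_mono) auto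
    also have "\<dots> \<le> e * (1 + (1 + M) * L + 2 * \<beta>)"
      using M(1) L e \<alpha>\<beta> by (simp add: algebra_simps)
    also have "\<dots> = \<epsilon>" using den by (simp add: e_def)
    finally have 1: "\<bar>q r - f r\<bar> \<le> \<epsilon>" .
    have "q' r - f' r = ?b' r * (P (r\<^sup>2) - Q (r\<^sup>2)) + ?b r * ((p (r\<^sup>2) - Q' (r\<^sup>2)) * (2 * r))"
      unfolding f'r q'_def by (simp add: algebra_simps)
    also have "\<bar>\<dots>\<bar> \<le> \<bar>?b' r\<bar> * \<bar>P (r\<^sup>2) - Q (r\<^sup>2)\<bar> + ?b r * (\<bar>p (r\<^sup>2) - Q' (r\<^sup>2)\<bar> * (2 * r))"
      using bump_nonneg[of \<alpha> \<beta> r] r2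
      by (intro order_trans[OF abs_triangle_ineq]) (simp add: abs_mult)
    also have "\<dots> \<le> M * (e * L) + 1 * (e * (2 * \<beta>))"
      using PQ[OF r2(1)] bump_nonneg[of \<alpha> \<beta> r] bump_le_1[of \<alpha> \<beta> r] M(1) M(2)[OF r] p(2)[OF r2(1)] r r2 e
      by (intro add_mono mult_mono mult_nonneg_nonneg) (auto simp: abs_minus_commute)
    also have "\<dots> \<le> e * (1 + (1 + M) * L + 2 * \<beta>)"
      using M(1) L e \<alpha>\<beta> by (simp add: algebra_simps)
    also have "\<dots> = \<epsilon>" using den by (simp add: e_def)
    finally show "\<bar>q r - f r\<bar> \<le> \<epsilon> \<and> \<bar>q' r - f' r\<bar> \<le> \<epsilon>" using 1 by simp
  qed
qed

section \<open>Reduction to one dimension\<close>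

text \<open>All three integrals are finite because the support is an annulus. The inequality in
  [0, \<infinity>] therefore becomes one between reals, and the area of the unit sphere
  cancels.\<close>

lemma bump_radial_hardy:
  fixes \<Omega> :: "(real ^ 'n) set"
  assumes H: "hardy_inequality \<Omega> a k c V" and kc: "0 \<le> k" "0 \<le> c"
    and \<alpha>\<beta>: "0 < \<alpha>" "\<alpha> < \<beta>"
    and V: "\<And>x :: real ^ 'n. norm x \<in> {\<alpha>..\<beta>} \<Longrightarrow> x \<in> \<Omega> \<and> V x = v (norm x)"
    and v: "continuous_on {\<alpha>..\<beta>} v" "\<And>r. r \<in> {\<alpha>..\<beta>} \<Longrightarrow> 0 \<le> v r"
    and P: "real_polynomial_function P" and q: "q = (\<lambda>r. bump \<alpha> \<beta> r * P (r\<^sup>2))"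
    and q': "\<And>r. (q has_real_derivative q' r) (at r)" "continuous_on UNIV q'"
  defines "d \<equiv> CARD('n) - 1"
  shows "k * integral {\<alpha>..\<beta>} (\<lambda>r. r ^ d * (r powr (- 2 * a - 2) * (q r)\<^sup>2))
     + c * integral {\<alpha>..\<beta>} (\<lambda>r. r ^ d * (v r * (q r)\<^sup>2))
    \<le> integral {\<alpha>..\<beta>} (\<lambda>r. r ^ d * (r powr (- 2 * a) * (q' r)\<^sup>2))"
    (is "k * ?I1 + c * ?I2 \<le> ?I0")
proof -
  let ?u = "\<lambda>x :: real ^ 'n. q (norm x)"
  let ?\<kappa> = "sphere_area CARD('n)"
  have \<kappa>: "0 < ?\<kappa>" by (simp add: sphere_area_pos)
  have u: "?u \<in> test_functions \<Omega>"
    unfolding q using V by (intro bump_radial_test_function \<alpha>\<beta> P) auto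
  have q0: "q r = 0" if "0 \<le> r" "r \<notin> {\<alpha>..\<beta>}" for r
    using that bump_eq_0_iff[OF \<alpha>\<beta>, of r] by (auto simp: q)
  have q'0: "q' r = 0" if "0 < r" "r \<notin> {\<alpha>..\<beta>}" for r
  proof -
    have "((\<lambda>_. 0) has_real_derivative q' r) (at r)"
    proof (rule has_field_derivative_transform_within_open[OF q'(1)])
      show "open ({0<..} - {\<alpha>..\<beta>})" by (intro open_Diff) auto
    qed (use that q0 in auto)
    then show ?thesis using DERIV_unique[OF DERIV_const] by metis
  qed
  have cq: "continuous_on {\<alpha>..\<beta>} q" "continuous_on {\<alpha>..\<beta>} q'"
    using q' by (auto intro: DERIV_isCont continuous_at_imp_continuous_on continuous_on_subset)
  have nz: "0 \<notin> {\<alpha>..\<beta>}" using \<alpha>\<beta> by simp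
  have c0: "continuous_on {\<alpha>..\<beta>} (\<lambda>r. r powr (- 2 * a) * (q' r)\<^sup>2)"
    using nz by (intro continuous_intros cq) auto
  have c1: "continuous_on {\<alpha>..\<beta>} (\<lambda>r. r powr (- 2 * a - 2) * (q r)\<^sup>2)"
    using nz by (intro continuous_intros cq) auto
  have c2: "continuous_on {\<alpha>..\<beta>} (\<lambda>r. v r * (q r)\<^sup>2)"
    by (intro continuous_intros cq v)
  have "(\<integral>\<^sup>+x\<in>\<Omega>. ennreal (norm x powr (- 2 * a) * (norm (grad ?u x))\<^sup>2) \<partial>lborel) =
    (\<integral>\<^sup>+x. ennreal (indicator {\<alpha>..\<beta>} (norm x) * (norm x powr (- 2 * a) * (q' (norm x))\<^sup>2)) \<partial>(lborel :: (real ^ 'n) measure))"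
  proof (intro nn_integral_cong)
    fix x :: "real ^ 'n"
    show "ennreal (norm x powr (- 2 * a) * (norm (grad ?u x))\<^sup>2) * indicator \<Omega> x =
      ennreal (indicator {\<alpha>..\<beta>} (norm x) * (norm x powr (- 2 * a) * (q' (norm x))\<^sup>2))"
    \<comment> \<open>\<open>norm_grad_radial\<close> speaks of nonzero points; at the origin the
      integrand is 0 because \<open>0 powr _ = 0\<close>.\<close>
    proof (cases "x = 0")
      case False
      then show ?thesis using V[of x] q'0[of "norm x"] norm_grad_radial[OF False q'(1)]
        by (cases "norm x \<in> {\<alpha>..\<beta>}") (auto simp: indicator_def)
    qed (use nz in \<open>simp add: indicator_def\<close>)
  qed
  also have "\<dots> = ennreal (?\<kappa> * ?I0)"
    using nn_integral_radial[where 'a = "real ^ 'n", OF \<alpha>\<beta>(1) c0] by (simp add: d_def)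
  finally have 0: "(\<integral>\<^sup>+x\<in>\<Omega>. ennreal (norm x powr (- 2 * a) * (norm (grad ?u x))\<^sup>2) \<partial>lborel) = ennreal (?\<kappa> * ?I0)" .
  have "(\<integral>\<^sup>+x\<in>\<Omega>. ennreal (norm x powr (- 2 * a - 2) * (?u x)\<^sup>2) \<partial>lborel) =
    (\<integral>\<^sup>+x. ennreal (indicator {\<alpha>..\<beta>} (norm x) * (norm x powr (- 2 * a - 2) * (q (norm x))\<^sup>2)) \<partial>(lborel :: (real ^ 'n) measure))"
  proof (intro nn_integral_cong)
    fix x :: "real ^ 'n"
    show "ennreal (norm x powr (- 2 * a - 2) * (q (norm x))\<^sup>2) * indicator \<Omega> x =
      ennreal (indicator {\<alpha>..\<beta>} (norm x) * (norm x powr (- 2 * a - 2) * (q (norm x))\<^sup>2))"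
      using V[of x] q0[of "norm x"] by (cases "norm x \<in> {\<alpha>..\<beta>}") (auto simp: indicator_def)
  qed
  also have "\<dots> = ennreal (?\<kappa> * ?I1)"
    using nn_integral_radial[where 'a = "real ^ 'n", OF \<alpha>\<beta>(1) c1] by (simp add: d_def)
  finally have 1: "(\<integral>\<^sup>+x\<in>\<Omega>. ennreal (norm x powr (- 2 * a - 2) * (?u x)\<^sup>2) \<partial>lborel) = ennreal (?\<kappa> * ?I1)" .
  have "(\<integral>\<^sup>+x\<in>\<Omega>. ennreal (V x * (?u x)\<^sup>2) \<partial>lborel) =
    (\<integral>\<^sup>+x. ennreal (indicator {\<alpha>..\<beta>} (norm x) * (v (norm x) * (q (norm x))\<^sup>2)) \<partial>(lborel :: (real ^ 'n) measure))"
  proof (intro nn_integral_cong)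
    fix x :: "real ^ 'n"
    show "ennreal (V x * (q (norm x))\<^sup>2) * indicator \<Omega> x =
      ennreal (indicator {\<alpha>..\<beta>} (norm x) * (v (norm x) * (q (norm x))\<^sup>2))"
      using V[of x] q0[of "norm x"] by (cases "norm x \<in> {\<alpha>..\<beta>}") (auto simp: indicator_def)
  qed
  also have "\<dots> = ennreal (?\<kappa> * ?I2)"
    using nn_integral_radial[where 'a = "real ^ 'n", OF \<alpha>\<beta>(1) c2] v(2) by (simp add: d_def)
  finally have 2: "(\<integral>\<^sup>+x\<in>\<Omega>. ennreal (V x * (?u x)\<^sup>2) \<partial>lborel) = ennreal (?\<kappa> * ?I2)" .
  have pos: "0 \<le> ?I0" "0 \<le> ?I1" "0 \<le> ?I2"
    using \<alpha>\<beta>(1) v(2) by (auto intro!: integral_nonneg integrable_continuous_real continuous_intros c0 c1 c2 cq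
        mult_nonneg_nonneg simp del: mult.assoc)
  have "ennreal k * ennreal (?\<kappa> * ?I1) + ennreal c * ennreal (?\<kappa> * ?I2) \<le> ennreal (?\<kappa> * ?I0)"
    using bspec[OF H[unfolded hardy_inequality_def] u] by (simp only: 0 1 2)
  then have "ennreal (?\<kappa> * (k * ?I1 + c * ?I2)) \<le> ennreal (?\<kappa> * ?I0)"
    using kc \<kappa> pos by (simp add: ennreal_mult'[symmetric] ennreal_plus[symmetric] algebra_simps del: ennreal_plus)
  then show ?thesis using \<kappa> pos by (simp add: ennreal_le_iff)
qed

section \<open>Passage from smooth to piecewise smooth profiles\<close>

definition piecewise_C1 :: "real \<Rightarrow> real \<Rightarrow> (real \<Rightarrow> real) \<Rightarrow> (real \<Rightarrow> real) \<Rightarrow> bool" where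
  "piecewise_C1 \<alpha> \<beta> g g' \<longleftrightarrow> continuous_on UNIV g \<and> (\<forall>r. r \<notin> {\<alpha>..\<beta>} \<longrightarrow> g r = 0 \<and> g' r = 0) \<and>
     (\<exists>N. finite N \<and> (\<forall>r. r \<notin> N \<longrightarrow> (g has_real_derivative g' r) (at r))) \<and> bounded (range g')"

text \<open>Integrability of the limit integrand is obtained together with the limit. This is how
  the derivative of a piecewise C1 profile, of which little more than a bound is known, enters the
  integrals.\<close>

lemma weighted_square_convergence:
  fixes w :: "real \<Rightarrow> real"
  assumes "continuous_on {\<alpha>..\<beta>} w" and g: "\<And>j. continuous_on {\<alpha>..\<beta>} (g j)"
    and C: "\<And>j r. r \<in> {\<alpha>..\<beta>} \<Longrightarrow> \<bar>g j r\<bar> \<le> C"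
    and N: "finite N" and lim: "\<And>r. r \<in> {\<alpha>..\<beta>} \<Longrightarrow> r \<notin> N \<Longrightarrow> (\<lambda>j. g j r) \<longlonglongrightarrow> h r"
  shows "(\<lambda>r. w r * (h r)\<^sup>2) integrable_on {\<alpha>..\<beta>}"
    and "(\<lambda>j. integral {\<alpha>..\<beta>} (\<lambda>r. w r * (g j r)\<^sup>2)) \<longlonglongrightarrow> integral {\<alpha>..\<beta>} (\<lambda>r. w r * (h r)\<^sup>2)"
proof -
  \<comment> \<open>Dominated convergence is applied in a form that asks for convergence at every
    point, so the sequence and its limit are both set to 0 on the finite set
    \<open>N\<close>.\<close>
  let ?F = "\<lambda>j r. if r \<in> N then 0 else w r * (g j r)\<^sup>2"
  let ?H = "\<lambda>r. if r \<in> N then 0 else w r * (h r)\<^sup>2"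
  have F: "?F j integrable_on {\<alpha>..\<beta>}" for j
    by (rule integrable_spike_finite[OF N, where f = "\<lambda>r. w r * (g j r)\<^sup>2"])
      (auto intro!: integrable_continuous_real continuous_intros assms(1) g)
  have B: "(\<lambda>r. \<bar>w r\<bar> * C\<^sup>2) integrable_on {\<alpha>..\<beta>}"
    by (auto intro!: integrable_continuous_real continuous_intros assms(1))
  have le: "norm (?F j r) \<le> \<bar>w r\<bar> * C\<^sup>2" if "r \<in> {\<alpha>..\<beta>}" for j r
  proof -
    have "(g j r)\<^sup>2 \<le> C\<^sup>2" using C[OF that, of j] by (intro power2_le_iff_abs_le[THEN iffD2]) auto
    then show ?thesis by (auto simp: abs_mult intro: mult_left_mono)
  qed
  have conv: "(\<lambda>j. ?F j r) \<longlonglongrightarrow> ?H r" if "r \<in> {\<alpha>..\<beta>}" for r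
    using lim[OF that] by (auto intro!: tendsto_intros)
  note dct = dominated_convergence[OF F B le conv]
  show "(\<lambda>r. w r * (h r)\<^sup>2) integrable_on {\<alpha>..\<beta>}"
    by (rule integrable_spike_finite[OF N _ dct(1)]) auto
  have "integral {\<alpha>..\<beta>} ?H = integral {\<alpha>..\<beta>} (\<lambda>r. w r * (h r)\<^sup>2)"
    "integral {\<alpha>..\<beta>} (?F j) = integral {\<alpha>..\<beta>} (\<lambda>r. w r * (g j r)\<^sup>2)" for j
    using N by (auto intro!: integral_spike[of N] negligible_finite)
  then show "(\<lambda>j. integral {\<alpha>..\<beta>} (\<lambda>r. w r * (g j r)\<^sup>2)) \<longlonglongrightarrow> integral {\<alpha>..\<beta>} (\<lambda>r. w r * (h r)\<^sup>2)"
    using dct(2) by simp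
qed

text \<open>\<open>piecewise_C1\<close> asks of \<open>g'\<close> on the support only that it is
  bounded and is the derivative off a finite set. The fundamental theorem for the Henstock-Kurzweil
  integral covers this, and the bound becomes a Lipschitz constant.\<close>

lemma piecewise_C1_lipschitz:
  assumes "piecewise_C1 \<alpha> \<beta> f f'"
  obtains M where "0 \<le> M" "\<And>x y. \<bar>f x - f y\<bar> \<le> M * \<bar>x - y\<bar>" "\<And>r. \<bar>f' r\<bar> \<le> M"
proof -
  obtain N where N: "finite N" "\<And>r. r \<notin> N \<Longrightarrow> (f has_real_derivative f' r) (at r)"
    using assms by (auto simp: piecewise_C1_def)
  obtain M where M: "0 < M" "\<And>r. \<bar>f' r\<bar> \<le> M"
    using assms by (auto simp: piecewise_C1_def bounded_pos)
  have *: "\<bar>f y - f x\<bar> \<le> M * (y - x)" if "x \<le> y" for x y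
  proof -
    have "(f' has_integral f y - f x) {x..y}"
      using assms N that
      by (intro fundamental_theorem_of_calculus_interior_strong[OF N(1)])
        (auto simp: piecewise_C1_def has_real_derivative_iff_has_vector_derivative[symmetric] intro: continuous_on_subset)
    then show ?thesis
      using has_integral_bound_real[of M "{}" f' "f y - f x" x y] M that by auto
  qed
  have "\<bar>f x - f y\<bar> \<le> M * \<bar>x - y\<bar>" for x y
    using *[of x y] *[of y x] by (cases "x \<le> y") (auto simp: abs_minus_commute)
  then show ?thesis using that[of M] M by auto
qed

text \<open>The Steklov averages \<open>(G (r + \<delta>) - G r) / \<delta>\<close> with \<open>G' = f\<close> are \<open>C\<^sup>1\<close>.\<close>

lemma piecewise_C1_approximation_by_bumps:
  assumes \<alpha>\<beta>: "0 < \<alpha>" "\<alpha> < \<alpha>1" "\<alpha>1 < \<beta>1" "\<beta>1 < \<beta>" and f: "piecewise_C1 \<alpha>1 \<beta>1 f f'"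
  obtains q q' P C N where "\<And>j :: nat. real_polynomial_function (P j)"
    "\<And>j. q j = (\<lambda>r. bump \<alpha> \<beta> r * P j (r\<^sup>2))"
    "\<And>j r. (q j has_real_derivative q' j r) (at r)" "\<And>j. continuous_on UNIV (q' j)"
    "\<And>j r. r \<in> {\<alpha>..\<beta>} \<Longrightarrow> \<bar>q j r\<bar> \<le> C" "\<And>j r. r \<in> {\<alpha>..\<beta>} \<Longrightarrow> \<bar>q' j r\<bar> \<le> C"
    "\<And>r. r \<in> {\<alpha>..\<beta>} \<Longrightarrow> (\<lambda>j. q j r) \<longlonglongrightarrow> f r"
    "finite N" "\<And>r. r \<in> {\<alpha>..\<beta>} \<Longrightarrow> r \<notin> N \<Longrightarrow> (\<lambda>j. q' j r) \<longlonglongrightarrow> f' r"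
proof -
  obtain N where N: "finite N" "\<And>r. r \<notin> N \<Longrightarrow> (f has_real_derivative f' r) (at r)"
    using f by (auto simp: piecewise_C1_def)
  obtain M where M: "0 \<le> M" "\<And>x y. \<bar>f x - f y\<bar> \<le> M * \<bar>x - y\<bar>" "\<And>r. \<bar>f' r\<bar> \<le> M"
    using piecewise_C1_lipschitz[OF f] by blast
  have f0: "f r = 0" if "r \<notin> {\<alpha>1..\<beta>1}" for r using f that by (auto simp: piecewise_C1_def)
  have f_cont: "isCont f r" for r
    using f by (auto simp: piecewise_C1_def continuous_on_eq_continuous_at)
  obtain G where "\<And>r. (G has_vector_derivative f r) (at r)"
    using einterval_antiderivative[of "-\<infinity>" "\<infinity>" f] f_cont by auto
  then have G: "(G has_real_derivative f r) (at r)" for r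
    by (simp add: has_real_derivative_iff_has_vector_derivative)
  \<comment> \<open>The averages look forward, so their support extends that of \<open>f\<close>
    only to the left, by at most \<open>\<delta>0\<close>. Half of the gap keeps it to the right of
    \<alpha>.\<close>
  define \<delta>0 where "\<delta>0 = (\<alpha>1 - \<alpha>) / 2"
  define \<delta> where "\<delta> j = \<delta>0 / real (Suc j)" for j
  have \<delta>0: "0 < \<delta>0" "\<alpha> < \<alpha>1 - \<delta>0" using \<alpha>\<beta> by (auto simp: \<delta>0_def field_simps)
  have \<delta>: "0 < \<delta> j" "\<delta> j \<le> \<delta>0" for j using \<delta>0 by (auto simp: \<delta>_def field_simps)
  have \<delta>_lim: "\<delta> \<longlonglongrightarrow> 0" unfolding \<delta>_def
    using LIMSEQ_Suc[OF lim_const_over_n[of \<delta>0]] by simp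
  define s where "s j r = (G (r + \<delta> j) - G r) / \<delta> j" for j r
  define s' where "s' j r = (f (r + \<delta> j) - f r) / \<delta> j" for j r
  have s: "(s j has_real_derivative s' j r) (at r)" for j r
  proof -
    have "((\<lambda>r. G (r + \<delta> j)) has_real_derivative f (r + \<delta> j)) (at r)"
      using DERIV_chain2[OF G DERIV_add[OF DERIV_ident DERIV_const[of "\<delta> j"]], of r UNIV] by simp
    then show ?thesis unfolding s_def[abs_def] s'_def
      by (intro DERIV_cdivide DERIV_diff G)
  qed
  have s'_cont: "continuous_on A (s' j)" for A j
  proof -
    have "isCont (\<lambda>r. f (r + \<delta> j)) r" for r by (intro isCont_o2[OF _ f_cont] continuous_intros)
    then show ?thesis unfolding s'_def[abs_def] using \<delta>[of j] f_cont
      by (intro continuous_intros) (auto simp: continuous_at_imp_continuous_on)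
  qed
  have s_mean: "\<exists>\<xi>. r < \<xi> \<and> \<xi> < r + \<delta> j \<and> s j r = f \<xi>" for j r
  proof -
    have "\<exists>\<xi>. r < \<xi> \<and> \<xi> < r + \<delta> j \<and> G (r + \<delta> j) - G r = (r + \<delta> j - r) * f \<xi>"
      using \<delta>(1)[of j] G by (intro MVT2) auto
    then show ?thesis using \<delta>(1)[of j] by (auto simp: s_def)
  qed
  have s0: "s j r = 0" if "r \<notin> {\<alpha>1 - \<delta>0..\<beta>1}" for j r
    using s_mean[where j = j and r = r] \<delta>[of j] that f0 by force
  have s_close: "\<bar>s j r - f r\<bar> \<le> M * \<delta> j" for j r
  proof -
    obtain \<xi> where \<xi>: "r < \<xi>" "\<xi> < r + \<delta> j" "s j r = f \<xi>" using s_mean by blast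
    have "\<bar>f \<xi> - f r\<bar> \<le> M * \<bar>\<xi> - r\<bar>" by (rule M)
    also have "\<dots> \<le> M * \<delta> j" using \<xi> M(1) by (intro mult_left_mono) auto
    finally show ?thesis using \<xi> by simp
  qed
  have s'_bd: "\<bar>s' j r\<bar> \<le> M" for j r
    using M(2)[of "r + \<delta> j" r] \<delta>(1)[of j] by (simp add: s'_def field_simps)
  have s'_lim: "(\<lambda>j. s' j r) \<longlonglongrightarrow> f' r" if "r \<notin> N" for r
  proof -
    have "((\<lambda>h. (f (r + h) - f r) / h) \<longlongrightarrow> f' r) (at 0)" using N(2)[OF that] by (simp add: DERIV_def)
    moreover have "filterlim \<delta> (at 0) sequentially"
      using \<delta>_lim \<delta>(1) by (intro filterlim_atI) (auto simp: less_imp_neq[THEN not_sym])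
    ultimately show ?thesis unfolding s'_def by (rule filterlim_compose)
  qed
  let ?approx = "\<lambda>j (q, q', P). real_polynomial_function P \<and> q = (\<lambda>r. bump \<alpha> \<beta> r * P (r\<^sup>2)) \<and>
      (\<forall>r. (q has_real_derivative q' r) (at r)) \<and> continuous_on UNIV q' \<and>
      (\<forall>r\<in>{\<alpha>..\<beta>}. \<bar>q r - s j r\<bar> \<le> \<delta> j \<and> \<bar>q' r - s' j r\<bar> \<le> \<delta> j)"
  have "\<exists>Z. ?approx j Z" for j
  proof -
    obtain q q' P where "real_polynomial_function P" "q = (\<lambda>r. bump \<alpha> \<beta> r * P (r\<^sup>2))"
      "\<And>r. (q has_real_derivative q' r) (at r)" "continuous_on UNIV q'"
      "\<And>r. r \<in> {\<alpha>..\<beta>} \<Longrightarrow> \<bar>q r - s j r\<bar> \<le> \<delta> j \<and> \<bar>q' r - s' j r\<bar> \<le> \<delta> j"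
      by (rule C1_approximation_by_bump[of \<alpha> "\<alpha>1 - \<delta>0" \<beta>1 \<beta> "s j" "s' j" "\<delta> j"])
        (use \<alpha>\<beta> \<delta>0 s s'_cont s0 \<delta>(1)[of j] in auto)
    then have "?approx j (q, q', P)" by simp
    then show ?thesis by (rule exI)
  qed
  then have "\<forall>j. \<exists>Z. ?approx j Z" by blast
  from choice[OF this] obtain Z where Z: "\<And>j. ?approx j (Z j)" by blast
  define q q' P where "q j = fst (Z j)" and "q' j = fst (snd (Z j))" and "P j = snd (snd (Z j))" for j
  have Q: "real_polynomial_function (P j)" "q j = (\<lambda>r. bump \<alpha> \<beta> r * P j (r\<^sup>2))"
      "(q j has_real_derivative q' j r) (at r)" "continuous_on UNIV (q' j)"
      "r \<in> {\<alpha>..\<beta>} \<Longrightarrow> \<bar>q j r - s j r\<bar> \<le> \<delta> j" "r \<in> {\<alpha>..\<beta>} \<Longrightarrow> \<bar>q' j r - s' j r\<bar> \<le> \<delta> j" for j r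
    using Z[of j] by (auto simp: q_def q'_def P_def split_beta)
  have q_close: "\<bar>q j r - f r\<bar> \<le> (1 + M) * \<delta> j" if "r \<in> {\<alpha>..\<beta>}" for j r
    using Q(5)[OF that, of j] s_close[of j r] by (simp add: algebra_simps)
  define C where "C = M * (\<beta> - \<alpha>) + (1 + M) * \<delta>0 + M + \<delta>0"
  show thesis
  proof
    fix j r assume r: "r \<in> {\<alpha>..\<beta>}"
    have "\<bar>f r - f \<alpha>\<bar> \<le> M * \<bar>r - \<alpha>\<bar>" by (rule M)
    also have "\<dots> \<le> M * (\<beta> - \<alpha>)" using r M(1) by (intro mult_left_mono) auto
    finally have "\<bar>f r\<bar> \<le> M * (\<beta> - \<alpha>)" using f0[of \<alpha>] \<alpha>\<beta> by simp
    moreover have "(1 + M) * \<delta> j \<le> (1 + M) * \<delta>0" using \<delta>(2)[of j] M(1) by (intro mult_left_mono) auto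
    ultimately show "\<bar>q j r\<bar> \<le> C" using q_close[OF r, of j] M(1) \<delta>0 unfolding C_def by linarith
    have "0 \<le> M * (\<beta> - \<alpha>) + (1 + M) * \<delta>0" using M(1) \<delta>0 \<alpha>\<beta> by simp
    then show "\<bar>q' j r\<bar> \<le> C" using Q(6)[OF r, of j] s'_bd[of j r] \<delta>(2)[of j] by (simp add: C_def)
  next
    fix r assume r: "r \<in> {\<alpha>..\<beta>}"
    have "(\<lambda>j. (1 + M) * \<delta> j) \<longlonglongrightarrow> 0" using \<delta>_lim by (rule tendsto_mult_right_zero)
    then have "(\<lambda>j. q j r - f r) \<longlonglongrightarrow> 0"
      by (rule Lim_null_comparison[rotated]) (use q_close[OF r] in auto)
    then show "(\<lambda>j. q j r) \<longlonglongrightarrow> f r" by (simp add: LIM_zero_iff)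
    have "(\<lambda>j. q' j r - s' j r) \<longlonglongrightarrow> 0"
      by (rule Lim_null_comparison[OF _ \<delta>_lim]) (use Q(6)[OF r] in auto)
    then show "(\<lambda>j. q' j r) \<longlonglongrightarrow> f' r" if "r \<notin> N"
      using tendsto_add[OF _ s'_lim[OF that], of "\<lambda>j. q' j r - s' j r" 0] by simp
  qed (use Q N in auto)
qed

lemma piecewise_C1_radial_hardy:
  fixes \<Omega> :: "(real ^ 'n) set"
  assumes H: "hardy_inequality \<Omega> a k c V" and kc: "0 \<le> k" "0 \<le> c"
    and \<alpha>\<beta>: "0 < \<alpha>" "\<alpha> < \<alpha>1" "\<alpha>1 < \<beta>1" "\<beta>1 < \<beta>"
    and V: "\<And>x :: real ^ 'n. norm x \<in> {\<alpha>..\<beta>} \<Longrightarrow> x \<in> \<Omega> \<and> V x = v (norm x)"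
    and v: "continuous_on {\<alpha>..\<beta>} v" "\<And>r. r \<in> {\<alpha>..\<beta>} \<Longrightarrow> 0 \<le> v r"
    and f: "piecewise_C1 \<alpha>1 \<beta>1 f f'"
  defines "d \<equiv> CARD('n) - 1"
  shows "(\<lambda>r. r ^ d * r powr (- 2 * a) * (f' r)\<^sup>2) integrable_on {\<alpha>..\<beta>}"
    and "(\<lambda>r. r ^ d * r powr (- 2 * a - 2) * (f r)\<^sup>2) integrable_on {\<alpha>..\<beta>}"
    and "(\<lambda>r. r ^ d * v r * (f r)\<^sup>2) integrable_on {\<alpha>..\<beta>}"
    and "k * integral {\<alpha>..\<beta>} (\<lambda>r. r ^ d * r powr (- 2 * a - 2) * (f r)\<^sup>2)
     + c * integral {\<alpha>..\<beta>} (\<lambda>r. r ^ d * v r * (f r)\<^sup>2)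
    \<le> integral {\<alpha>..\<beta>} (\<lambda>r. r ^ d * r powr (- 2 * a) * (f' r)\<^sup>2)"
proof -
  obtain q q' P C N where Q: "\<And>j :: nat. real_polynomial_function (P j)"
    "\<And>j. q j = (\<lambda>r. bump \<alpha> \<beta> r * P j (r\<^sup>2))"
    "\<And>j r. (q j has_real_derivative q' j r) (at r)" "\<And>j. continuous_on UNIV (q' j)"
    and C: "\<And>j r. r \<in> {\<alpha>..\<beta>} \<Longrightarrow> \<bar>q j r\<bar> \<le> C" "\<And>j r. r \<in> {\<alpha>..\<beta>} \<Longrightarrow> \<bar>q' j r\<bar> \<le> C"
    and q_lim: "\<And>r. r \<in> {\<alpha>..\<beta>} \<Longrightarrow> (\<lambda>j. q j r) \<longlonglongrightarrow> f r"
    and N: "finite N" "\<And>r. r \<in> {\<alpha>..\<beta>} \<Longrightarrow> r \<notin> N \<Longrightarrow> (\<lambda>j. q' j r) \<longlonglongrightarrow> f' r"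
    by (rule piecewise_C1_approximation_by_bumps[OF \<alpha>\<beta> f]) (rule that; assumption)
  have cq: "continuous_on {\<alpha>..\<beta>} (q j)" "continuous_on {\<alpha>..\<beta>} (q' j)" for j
    using Q(3,4) by (auto intro: DERIV_isCont continuous_at_imp_continuous_on continuous_on_subset)
  have nz: "0 \<notin> {\<alpha>..\<beta>}" using \<alpha>\<beta> by simp
  have w: "continuous_on {\<alpha>..\<beta>} (\<lambda>r. r ^ d * r powr (- 2 * a))"
    "continuous_on {\<alpha>..\<beta>} (\<lambda>r. r ^ d * r powr (- 2 * a - 2))"
    "continuous_on {\<alpha>..\<beta>} (\<lambda>r. r ^ d * v r)"
    using nz by (auto intro!: continuous_intros v)
  note l0 = weighted_square_convergence[OF w(1) cq(2) C(2) N]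
  note l1 = weighted_square_convergence[OF w(2) cq(1) C(1) finite.emptyI q_lim]
  note l2 = weighted_square_convergence[OF w(3) cq(1) C(1) finite.emptyI q_lim]
  show "(\<lambda>r. r ^ d * r powr (- 2 * a) * (f' r)\<^sup>2) integrable_on {\<alpha>..\<beta>}"
    "(\<lambda>r. r ^ d * r powr (- 2 * a - 2) * (f r)\<^sup>2) integrable_on {\<alpha>..\<beta>}"
    "(\<lambda>r. r ^ d * v r * (f r)\<^sup>2) integrable_on {\<alpha>..\<beta>}"
    by (rule l0(1) l1(1) l2(1); assumption)+
  have "k * integral {\<alpha>..\<beta>} (\<lambda>r. r ^ d * r powr (- 2 * a - 2) * (q j r)\<^sup>2)
     + c * integral {\<alpha>..\<beta>} (\<lambda>r. r ^ d * v r * (q j r)\<^sup>2)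
    \<le> integral {\<alpha>..\<beta>} (\<lambda>r. r ^ d * r powr (- 2 * a) * (q' j r)\<^sup>2)" for j
    using bump_radial_hardy[OF H kc \<alpha>\<beta>(1) _ V v Q(1,2,3,4), of j] \<alpha>\<beta> by (simp add: d_def mult.assoc)
  then show "k * integral {\<alpha>..\<beta>} (\<lambda>r. r ^ d * r powr (- 2 * a - 2) * (f r)\<^sup>2)
     + c * integral {\<alpha>..\<beta>} (\<lambda>r. r ^ d * v r * (f r)\<^sup>2)
    \<le> integral {\<alpha>..\<beta>} (\<lambda>r. r ^ d * r powr (- 2 * a) * (f' r)\<^sup>2)"
    by (intro LIMSEQ_le[OF tendsto_add[OF tendsto_mult_left[OF l1(2)] tendsto_mult_left[OF l2(2)]] l0(2)]) auto
qed

section \<open>Removal of the Hardy term\<close>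

text \<open>The substitution \<open>f = r powr (- m / 2) * g\<close> removes the Hardy term from the radial inequality.\<close>

definition log_hardy :: "real \<Rightarrow> (real \<Rightarrow> real) \<Rightarrow> bool" where
  "log_hardy R w \<longleftrightarrow> (\<forall>\<alpha> \<beta> g g'. 0 < \<alpha> \<longrightarrow> \<alpha> < \<beta> \<longrightarrow> \<beta> < R \<longrightarrow> piecewise_C1 \<alpha> \<beta> g g' \<longrightarrow>
     integral {\<alpha>..\<beta>} (\<lambda>r. w r * (g r)\<^sup>2) \<le> integral {\<alpha>..\<beta>} (\<lambda>r. r * (g' r)\<^sup>2))"

lemma integral_shrink:
  fixes F :: "real \<Rightarrow> real"
  assumes "\<alpha>0 \<le> \<alpha>" "\<beta> \<le> \<beta>0" "\<And>r. r \<notin> {\<alpha>..\<beta>} \<Longrightarrow> F r = 0"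
  shows "integral {\<alpha>0..\<beta>0} F = integral {\<alpha>..\<beta>} F"
proof -
  have "(\<lambda>x. if x \<in> {\<alpha>0..\<beta>0} then F x else 0) = (\<lambda>x. if x \<in> {\<alpha>..\<beta>} then F x else 0)"
    using assms by force
  then have "integral UNIV (\<lambda>x. if x \<in> {\<alpha>0..\<beta>0} then F x else 0) =
      integral UNIV (\<lambda>x. if x \<in> {\<alpha>..\<beta>} then F x else 0)" by (rule arg_cong)
  then show ?thesis by (simp only: Henstock_Kurzweil_Integration.integral_restrict_UNIV)
qed

text \<open>The constant \<open>k\<close> is kept apart from \<open>K\<close>: for k = K the term in
  1 / r disappears, which leads to the Bessel equation, while for k > K it survives and contradicts
  optimality. A general \<open>v\<close> covers both potentials of the theorem, with and without the
  factor |x| powr (- 2a).\<close>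

lemma hardy_inequality_imp_log_hardy:
  fixes \<Omega> :: "(real ^ 'n) set" and a :: real
  defines "K \<equiv> ((real CARD('n) - 2 * a - 2) / 2)\<^sup>2"
  assumes H: "hardy_inequality \<Omega> a k c V" and kc: "0 \<le> k" "0 \<le> c"
    and a: "a \<le> (real CARD('n) - 2) / 2"
    and V: "\<And>x :: real ^ 'n. 0 < norm x \<Longrightarrow> norm x < R \<Longrightarrow> x \<in> \<Omega> \<and> V x = v (norm x)"
    and v: "continuous_on {0<..<R} v" "\<And>r. 0 < r \<Longrightarrow> r < R \<Longrightarrow> 0 \<le> v r"
  shows "log_hardy R (\<lambda>r. (k - K) / r + c * (r powr (1 + 2 * a) * v r))"
  unfolding log_hardy_def
proof (intro allI impI)
  fix \<alpha> \<beta> g g' assume \<alpha>\<beta>: "0 < \<alpha>" "\<alpha> < \<beta>" "\<beta> < R" and g: "piecewise_C1 \<alpha> \<beta> g g'"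
  define m where "m = real CARD('n) - 2 * a - 2"
  have m: "0 \<le> m" using a by (simp add: m_def)
  \<comment> \<open>The approximating bumps need an interval strictly larger than the support of
    \<open>g\<close>, still inside (0, R).\<close>
  define \<alpha>0 \<beta>0 where "\<alpha>0 = \<alpha> / 2" and "\<beta>0 = (\<beta> + R) / 2"
  have 0: "0 < \<alpha>0" "\<alpha>0 < \<alpha>" "\<beta> < \<beta>0" "\<beta>0 < R" using \<alpha>\<beta> by (auto simp: \<alpha>0_def \<beta>0_def)
  obtain N where N: "finite N" "\<And>r. r \<notin> N \<Longrightarrow> (g has_real_derivative g' r) (at r)"
    using g by (auto simp: piecewise_C1_def)
  have g0: "g r = 0" "g' r = 0" if "r \<notin> {\<alpha>..\<beta>}" for r using g that by (auto simp: piecewise_C1_def)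
  have gc: "continuous_on A g" for A using g by (auto simp: piecewise_C1_def intro: continuous_on_subset)
  define f where "f r = r powr (- m / 2) * g r" for r
  define f' where "f' r = r powr (- m / 2) * (g' r - m / 2 * g r / r)" for r
  have far: "f r = 0" "f' r = 0" if "r \<notin> {\<alpha>..\<beta>}" for r using g0[OF that] by (simp_all add: f_def f'_def)
  have f: "piecewise_C1 \<alpha> \<beta> f f'" unfolding piecewise_C1_def
  proof (intro conjI allI impI exI)
    have "continuous_on {0<..} f" unfolding f_def[abs_def] by (intro continuous_intros gc) auto
    moreover have "continuous_on {..<\<alpha>} f"
      by (rule continuous_on_eq[of _ "\<lambda>_. 0"]) (auto simp: far)
    moreover have "(UNIV :: real set) = {0<..} \<union> {..<\<alpha>}" using \<alpha>\<beta> by auto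
    ultimately show "continuous_on UNIV f" by (metis continuous_on_open_Un open_greaterThan open_lessThan)
    show "finite N" by fact
    show "(f has_real_derivative f' r) (at r)" if "r \<notin> N" for r
    proof (cases "0 < r")
      case True
      have "((\<lambda>r. r powr (- m / 2)) has_real_derivative - m / 2 * (r powr (- m / 2) / r)) (at r)"
        using DERIV_powr[OF DERIV_ident True DERIV_const[of "- m / 2"]] True by (simp add: field_simps)
      from DERIV_mult[OF this N(2)[OF that]] show ?thesis
        unfolding f_def[abs_def] f'_def using True
        by (elim DERIV_cong) (simp add: algebra_simps)
    next
      case False
      have "((\<lambda>_. 0) has_real_derivative 0) (at r)" by simp
      then have "(f has_real_derivative 0) (at r)"
        by (rule has_field_derivative_transform_within_open[of _ _ _ "{..<\<alpha>}"]) (use False \<alpha>\<beta> far in auto)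
      then show ?thesis using far(2)[of r] False \<alpha>\<beta> by simp
    qed
    obtain M where M: "0 < M" "\<And>r. \<bar>g' r\<bar> \<le> M" using g by (auto simp: piecewise_C1_def bounded_pos)
    have "bounded (g ` {\<alpha>..\<beta>})" by (intro compact_imp_bounded compact_continuous_image gc compact_Icc)
    then obtain L where L: "0 < L" "\<And>r. r \<in> {\<alpha>..\<beta>} \<Longrightarrow> \<bar>g r\<bar> \<le> L" by (auto simp: bounded_pos)
    have "\<bar>f' r\<bar> \<le> \<alpha> powr (- m / 2) * (M + m / 2 * L / \<alpha>)" for r
    proof (cases "r \<in> {\<alpha>..\<beta>}")
      case True
      then have r: "0 < r" "\<alpha> \<le> r" using \<alpha>\<beta> by auto
      have "\<bar>g' r - m / 2 * g r / r\<bar> \<le> \<bar>g' r\<bar> + \<bar>m / 2 * g r / r\<bar>" by (rule abs_triangle_ineq4)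
      also have "\<bar>m / 2 * g r / r\<bar> = m / 2 * \<bar>g r\<bar> / r" using m r by (simp add: abs_mult)
      also have "\<dots> \<le> m / 2 * L / \<alpha>" using m r L(2)[OF True] \<alpha>\<beta> by (intro frac_le mult_left_mono mult_nonneg_nonneg) auto
      finally have "\<bar>g' r - m / 2 * g r / r\<bar> \<le> M + m / 2 * L / \<alpha>" using M(2)[of r] by simp
      moreover have "r powr (- m / 2) \<le> \<alpha> powr (- m / 2)" using r \<alpha>\<beta> m by (intro powr_mono2') auto
      ultimately show ?thesis unfolding f'_def abs_mult by (intro mult_mono) auto
    qed (use far M L m \<alpha>\<beta> in simp)
    then show "bounded (range f')" by (auto simp: bounded_iff)
  qed (simp_all add: far)
  have v0: "continuous_on {\<alpha>0..\<beta>0} v" using 0 by (intro continuous_on_subset[OF v(1)]) auto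
  have V0: "x \<in> \<Omega> \<and> V x = v (norm x)" if "norm x \<in> {\<alpha>0..\<beta>0}" for x
    using that 0 by (intro V) auto
  have v1: "0 \<le> v r" if "r \<in> {\<alpha>0..\<beta>0}" for r using that 0 by (intro v(2)) auto
  define d where "d = CARD('n) - 1"
  \<comment> \<open>The volume factor r ^ (n - 1) times r powr (- 2a) times the squared substitution
    factor r powr (- m) is therefore exactly r, the weight in \<open>log_hardy\<close>.\<close>
  have d: "real d = m + 1 + 2 * a" by (simp add: d_def m_def of_nat_diff)
  let ?J = "{\<alpha>0..\<beta>0}"
  have I: "(\<lambda>r. r ^ d * r powr (- 2 * a) * (f' r)\<^sup>2) integrable_on ?J"
    "(\<lambda>r. r ^ d * r powr (- 2 * a - 2) * (f r)\<^sup>2) integrable_on ?J"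
    "(\<lambda>r. r ^ d * v r * (f r)\<^sup>2) integrable_on ?J"
    "k * integral ?J (\<lambda>r. r ^ d * r powr (- 2 * a - 2) * (f r)\<^sup>2)
     + c * integral ?J (\<lambda>r. r ^ d * v r * (f r)\<^sup>2)
    \<le> integral ?J (\<lambda>r. r ^ d * r powr (- 2 * a) * (f' r)\<^sup>2)"
    by (rule piecewise_C1_radial_hardy[OF H kc 0(1,2) \<alpha>\<beta>(2) 0(3) V0 v0 v1 f, folded d_def]; assumption)+
  have pos: "0 < r" if "r \<in> ?J" for r using that 0 by auto
  have e0: "r ^ d * r powr (- 2 * a) * (r powr (- m / 2))\<^sup>2 = r"
    and e1: "r ^ d * r powr (- 2 * a - 2) * (r powr (- m / 2))\<^sup>2 = 1 / r"
    and e2: "r ^ d * (r powr (- m / 2))\<^sup>2 = r powr (1 + 2 * a)" if "r \<in> ?J" for r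
  proof -
    have "r ^ d = r powr (m + 1 + 2 * a)" "(r powr (- m / 2))\<^sup>2 = r powr (- m)"
      using pos[OF that] by (simp_all add: powr_realpow[symmetric] d power2_eq_square powr_add[symmetric])
    then show "r ^ d * r powr (- 2 * a) * (r powr (- m / 2))\<^sup>2 = r"
      "r ^ d * r powr (- 2 * a - 2) * (r powr (- m / 2))\<^sup>2 = 1 / r"
      "r ^ d * (r powr (- m / 2))\<^sup>2 = r powr (1 + 2 * a)"
      using pos[OF that] by (simp_all add: powr_add[symmetric] powr_diff[symmetric] powr_minus_divide)
  qed
  have w0: "r ^ d * r powr (- 2 * a) * (f' r)\<^sup>2 = r * (g' r)\<^sup>2 - m * (g r * g' r) + K * ((g r)\<^sup>2 / r)" if "r \<in> ?J" for r
  proof -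
    have "r ^ d * r powr (- 2 * a) * (f' r)\<^sup>2 = r * (g' r - m / 2 * g r / r)\<^sup>2"
      by (subst (3) e0[OF that, symmetric]) (simp add: f'_def power_mult_distrib)
    also have "\<dots> = r * (g' r)\<^sup>2 - m * (g r * g' r) + (m / 2)\<^sup>2 * ((g r)\<^sup>2 / r)"
      using pos[OF that] by (simp add: power2_eq_square field_simps)
    finally show ?thesis by (simp only: K_def m_def)
  qed
  have w1: "r ^ d * r powr (- 2 * a - 2) * (f r)\<^sup>2 = (g r)\<^sup>2 / r" if "r \<in> ?J" for r
    using arg_cong[OF e1[OF that], of "\<lambda>z. z * (g r)\<^sup>2"] by (simp add: f_def power_mult_distrib)
  have w2: "r ^ d * v r * (f r)\<^sup>2 = r powr (1 + 2 * a) * v r * (g r)\<^sup>2" if "r \<in> ?J" for r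
    by (subst e2[OF that, symmetric]) (simp add: f_def power_mult_distrib)
  \<comment> \<open>The cross term of the expanded square is the derivative of g ^ 2 / 2, and
    \<open>g\<close> vanishes at both ends.\<close>
  have gg: "((\<lambda>r. g r * g' r) has_integral 0) ?J"
  proof -
    have "((\<lambda>r. g r * g' r) has_integral (g \<beta>0)\<^sup>2 / 2 - (g \<alpha>0)\<^sup>2 / 2) ?J"
    proof (rule fundamental_theorem_of_calculus_interior_strong[OF N(1)])
      show "((\<lambda>r. (g r)\<^sup>2 / 2) has_vector_derivative g r * g' r) (at r)" if "r \<in> {\<alpha>0<..<\<beta>0} - N" for r
        unfolding has_real_derivative_iff_has_vector_derivative[symmetric]
        using N(2)[of r] that by (auto intro!: derivative_eq_intros)
    qed (use 0 \<alpha>\<beta> in \<open>auto intro!: continuous_intros gc\<close>)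
    then show ?thesis using g0[of \<alpha>0] g0[of \<beta>0] 0 by simp
  qed
  define A0 A1 A2 where "A0 = integral ?J (\<lambda>r. r ^ d * r powr (- 2 * a) * (f' r)\<^sup>2)"
    and "A1 = integral ?J (\<lambda>r. r ^ d * r powr (- 2 * a - 2) * (f r)\<^sup>2)"
    and "A2 = integral ?J (\<lambda>r. r ^ d * v r * (f r)\<^sup>2)"
  have h0: "((\<lambda>r. r * (g' r)\<^sup>2 - m * (g r * g' r) + K * ((g r)\<^sup>2 / r)) has_integral A0) ?J"
    using integrable_integral[OF I(1)] unfolding A0_def by (rule has_integral_eq[rotated]) (rule w0)
  have h1: "((\<lambda>r. (g r)\<^sup>2 / r) has_integral A1) ?J"
    using integrable_integral[OF I(2)] unfolding A1_def by (rule has_integral_eq[rotated]) (rule w1)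
  have h2: "((\<lambda>r. r powr (1 + 2 * a) * v r * (g r)\<^sup>2) has_integral A2) ?J"
    using integrable_integral[OF I(3)] unfolding A2_def by (rule has_integral_eq[rotated]) (rule w2)
  have "((\<lambda>r. r * (g' r)\<^sup>2) has_integral A0 + m * 0 - K * A1) ?J"
    using has_integral_diff[OF has_integral_add[OF h0 has_integral_mult_right[OF gg, of m]] has_integral_mult_right[OF h1, of K]]
    by (simp add: algebra_simps)
  then have L: "integral ?J (\<lambda>r. r * (g' r)\<^sup>2) = A0 - K * A1" by (simp add: integral_unique)
  have "((\<lambda>r. ((k - K) / r + c * (r powr (1 + 2 * a) * v r)) * (g r)\<^sup>2) has_integral (k - K) * A1 + c * A2) ?J"
    using has_integral_add[OF has_integral_mult_right[OF h1, of "k - K"] has_integral_mult_right[OF h2, of c]]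
    by (simp add: algebra_simps)
  then have R: "integral ?J (\<lambda>r. ((k - K) / r + c * (r powr (1 + 2 * a) * v r)) * (g r)\<^sup>2) = (k - K) * A1 + c * A2"
    by (rule integral_unique)
  have shrink: "integral ?J F = integral {\<alpha>..\<beta>} F" if "\<And>r. r \<notin> {\<alpha>..\<beta>} \<Longrightarrow> F r = 0" for F :: "real \<Rightarrow> real"
    by (rule integral_shrink) (use 0 that in auto)
  have "k * A1 + c * A2 \<le> A0" using I(4) by (simp add: A0_def A1_def A2_def)
  then have "integral ?J (\<lambda>r. ((k - K) / r + c * (r powr (1 + 2 * a) * v r)) * (g r)\<^sup>2) \<le> integral ?J (\<lambda>r. r * (g' r)\<^sup>2)"
    unfolding L R by (simp add: algebra_simps)
  moreover have "integral ?J (\<lambda>r. r * (g' r)\<^sup>2) = integral {\<alpha>..\<beta>} (\<lambda>r. r * (g' r)\<^sup>2)"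
    by (rule shrink) (drule g0(2), simp)
  moreover have "integral ?J (\<lambda>r. ((k - K) / r + c * (r powr (1 + 2 * a) * v r)) * (g r)\<^sup>2) =
      integral {\<alpha>..\<beta>} (\<lambda>r. ((k - K) / r + c * (r powr (1 + 2 * a) * v r)) * (g r)\<^sup>2)"
    by (rule shrink) (drule g0(1), simp)
  ultimately show "integral {\<alpha>..\<beta>} (\<lambda>r. ((k - K) / r + c * (r powr (1 + 2 * a) * v r)) * (g r)\<^sup>2)
     \<le> integral {\<alpha>..\<beta>} (\<lambda>r. r * (g' r)\<^sup>2)" by (simp only:)
qed

section \<open>A priori bound for Riccati subsolutions\<close>

text \<open>The test function rises logarithmically from 0 to 1 with small energy \<open>\<epsilon>\<close>, follows the
  solution \<open>z = exp (- \<integral> p / r)\<close> of the linear equation on \<open>{\<sigma>..s}\<close>, and falls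
  logarithmically to 0 on \<open>{s..b}\<close>, where the energy is \<open>(z s)\<^sup>2 / ln (b / s)\<close>.\<close>

lemma log_hardy_riccati_bound:
  assumes H: "log_hardy R w" and w: "continuous_on {0<..<R} w" "\<And>r. 0 < r \<Longrightarrow> r < R \<Longrightarrow> 0 \<le> w r"
    and \<sigma>: "0 < \<sigma>" "\<sigma> < s" "s < b" "b < R"
    and p: "continuous_on {\<sigma>..s} p" "p \<sigma> = 0"
      "\<And>r. \<sigma> < r \<Longrightarrow> r < s \<Longrightarrow> (p has_real_derivative p' r) (at r)"
      "\<And>r. \<sigma> < r \<Longrightarrow> r < s \<Longrightarrow> p' r \<le> w r + (p r)\<^sup>2 / r"
  shows "p s \<le> 1 / ln (b / s)"
proof -
  define l where "l = ln (b / s)"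
  have l: "0 < l" using \<sigma> by (simp add: l_def)
  have "continuous_on {\<sigma>..s} (\<lambda>r. p r / r)"
    using \<sigma> by (intro continuous_intros p(1)) auto
  then obtain A where A: "\<And>r. r \<in> {\<sigma>..s} \<Longrightarrow> (A has_vector_derivative p r / r) (at r within {\<sigma>..s})"
    using antiderivative_continuous by blast
  define z where "z r = exp (A \<sigma> - A r)" for r
  have A_cont: "continuous_on {\<sigma>..s} A"
    unfolding continuous_on_eq_continuous_within using has_vector_derivative_continuous[OF A] by blast
  have z_cont: "continuous_on {\<sigma>..s} z"
    unfolding z_def[abs_def] by (intro continuous_intros A_cont)
  have z: "(z has_real_derivative - p r * z r / r) (at r)" if "\<sigma> < r" "r < s" for r
  proof -
    have "(A has_real_derivative p r / r) (at r)"
      using A[of r] that by (simp add: has_real_derivative_iff_has_vector_derivative at_within_Icc_at)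
    then show ?thesis unfolding z_def[abs_def] by (auto intro!: derivative_eq_intros)
  qed
  have z_pos: "0 < z r" for r by (simp add: z_def)
  have z_\<sigma>: "z \<sigma> = 1" by (simp add: z_def)
  define I where "I = integral {\<sigma>..s} (\<lambda>r. (p r)\<^sup>2 * (z r)\<^sup>2 / r)"
  have nz: "0 \<notin> {\<sigma>..s}" using \<sigma> by simp
  have wc: "continuous_on {u..v} w" if "0 < u" "v < R" for u v
    using that by (intro continuous_on_subset[OF w(1)]) auto
  have pz_int: "(\<lambda>r. (p r)\<^sup>2 * (z r)\<^sup>2 / r) integrable_on {\<sigma>..s}"
    using nz by (intro integrable_continuous_real continuous_intros p z_cont) auto
  have wz_int: "(\<lambda>r. w r * (z r)\<^sup>2) integrable_on {\<sigma>..s}"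
    using \<sigma> by (intro integrable_continuous_real continuous_intros wc z_cont) auto
  have bound: "integral {\<sigma>..s} (\<lambda>r. w r * (z r)\<^sup>2) \<le> \<epsilon> + I + (z s)\<^sup>2 / l" if \<epsilon>: "0 < \<epsilon>" for \<epsilon>
  proof -
    \<comment> \<open>With slope \<epsilon> in the variable ln r, a rise from 0 to 1 takes
      logarithmic length 1 / \<epsilon> and costs \<epsilon> ^ 2 * (1 / \<epsilon>) =
      \<epsilon>.\<close>
    define a where "a = \<sigma> * exp (- (1 / \<epsilon>))"
    have a: "0 < a" "a < \<sigma>" using \<sigma> \<epsilon> by (auto simp: a_def)
    have ln_a: "ln a = ln \<sigma> - 1 / \<epsilon>" using \<sigma> by (simp add: a_def ln_mult)
    have ln_b: "ln b = ln s + l" using \<sigma> by (simp add: l_def ln_div)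
    define g where "g r = (if r < a then 0 else if r < \<sigma> then 1 + \<epsilon> * (ln r - ln \<sigma>) else if r < s then z r
      else if r < b then z s * (1 - (ln r - ln s) / l) else 0)" for r
    define g' where "g' r = (if r < a then 0 else if r < \<sigma> then \<epsilon> / r else if r < s then - p r * z r / r
      else if r < b then - z s / (l * r) else 0)" for r
    note order = \<open>0 < \<sigma>\<close> \<open>\<sigma> < s\<close> \<open>s < b\<close> \<open>0 < a\<close> \<open>a < \<sigma>\<close>
    have g_eq: "r \<le> a \<Longrightarrow> g r = 0" "a \<le> r \<Longrightarrow> r \<le> \<sigma> \<Longrightarrow> g r = 1 + \<epsilon> * (ln r - ln \<sigma>)"
      "\<sigma> \<le> r \<Longrightarrow> r \<le> s \<Longrightarrow> g r = z r" "s \<le> r \<Longrightarrow> r \<le> b \<Longrightarrow> g r = z s * (1 - (ln r - ln s) / l)"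
      "b \<le> r \<Longrightarrow> g r = 0" for r
      using order l \<epsilon> z_\<sigma> ln_a ln_b by (auto simp: g_def)
    have g_cont: "continuous_on UNIV g"
    proof -
      have "continuous_on {..a} g" by (rule continuous_on_eq[of _ "\<lambda>_. 0"]) (auto simp: g_eq)
      moreover have "continuous_on {a..\<sigma>} g"
        by (rule continuous_on_eq[of _ "\<lambda>r. 1 + \<epsilon> * (ln r - ln \<sigma>)"])
          (use order in \<open>auto simp: g_eq intro!: continuous_intros\<close>)
      moreover have "continuous_on {\<sigma>..s} g"
        by (rule continuous_on_eq[OF z_cont]) (auto simp: g_eq)
      moreover have "continuous_on {s..b} g"
        by (rule continuous_on_eq[of _ "\<lambda>r. z s * (1 - (ln r - ln s) / l)"])
          (use order l in \<open>auto simp: g_eq intro!: continuous_intros\<close>)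
      moreover have "continuous_on {b..} g" by (rule continuous_on_eq[of _ "\<lambda>_. 0"]) (auto simp: g_eq)
      ultimately have "continuous_on ({..a} \<union> ({a..\<sigma>} \<union> ({\<sigma>..s} \<union> ({s..b} \<union> {b..})))) g"
        by (intro continuous_on_closed_Un closed_Un) auto
      moreover have "{..a} \<union> ({a..\<sigma>} \<union> ({\<sigma>..s} \<union> ({s..b} \<union> {b..}))) = UNIV" using order by auto
      ultimately show ?thesis by simp
    qed
    have g'_eq: "r < a \<Longrightarrow> g' r = 0" "a < r \<Longrightarrow> r < \<sigma> \<Longrightarrow> g' r = \<epsilon> / r"
      "\<sigma> < r \<Longrightarrow> r < s \<Longrightarrow> g' r = - p r * z r / r" "s < r \<Longrightarrow> r < b \<Longrightarrow> g' r = - z s / (l * r)"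
      "b < r \<Longrightarrow> g' r = 0" for r
      using order by (auto simp: g'_def)
    have g_deriv: "(g has_real_derivative g' r) (at r)" if "r \<notin> {a, \<sigma>, s, b}" for r
    proof -
      have "r < a \<or> (a < r \<and> r < \<sigma>) \<or> (\<sigma> < r \<and> r < s) \<or> (s < r \<and> r < b) \<or> b < r"
        using that by auto
      then consider "r < a" | "a < r" "r < \<sigma>" | "\<sigma> < r" "r < s" | "s < r" "r < b" | "b < r"
        by blast
      then show ?thesis
      proof cases
        case 1
        show ?thesis unfolding g'_eq(1)[OF 1]
          by (rule has_field_derivative_transform_within_open[OF DERIV_const, of "{..<a}"])
            (use 1 in \<open>auto simp: g_eq\<close>)
      next
        case 2
        have "((\<lambda>r. 1 + \<epsilon> * (ln r - ln \<sigma>)) has_real_derivative \<epsilon> / r) (at r)"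
          using 2 order by (auto intro!: derivative_eq_intros)
        then show ?thesis unfolding g'_eq(2)[OF 2]
          by (rule has_field_derivative_transform_within_open[of _ _ _ "{a<..<\<sigma>}"])
            (use 2 in \<open>auto simp: g_eq\<close>)
      next
        case 3
        show ?thesis unfolding g'_eq(3)[OF 3]
          by (rule has_field_derivative_transform_within_open[OF z[OF 3], of "{\<sigma><..<s}"])
            (use 3 in \<open>auto simp: g_eq\<close>)
      next
        case 4
        have "((\<lambda>r. z s * (1 - (ln r - ln s) / l)) has_real_derivative - z s / (l * r)) (at r)"
          using 4 order l by (auto intro!: derivative_eq_intros)
        then show ?thesis unfolding g'_eq(4)[OF 4]
          by (rule has_field_derivative_transform_within_open[of _ _ _ "{s<..<b}"])
            (use 4 in \<open>auto simp: g_eq\<close>)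
      next
        case 5
        show ?thesis unfolding g'_eq(5)[OF 5]
          by (rule has_field_derivative_transform_within_open[OF DERIV_const, of "{b<..}"])
            (use 5 in \<open>auto simp: g_eq\<close>)
      qed
    qed
    have "range g' \<subseteq> {0} \<union> (\<lambda>r. \<epsilon> / r) ` {a..\<sigma>} \<union> (\<lambda>r. - p r * z r / r) ` {\<sigma>..s} \<union> (\<lambda>r. - z s / (l * r)) ` {s..b}"
      by (auto simp: g'_def)
    moreover have bdd: "bounded ((\<lambda>r. \<epsilon> / r) ` {a..\<sigma>})" "bounded ((\<lambda>r. - p r * z r / r) ` {\<sigma>..s})"
      "bounded ((\<lambda>r. - z s / (l * r)) ` {s..b})"
      using order l by (auto intro!: compact_imp_bounded compact_continuous_image continuous_intros p z_cont)
    have "bounded ({0} \<union> (\<lambda>r. \<epsilon> / r) ` {a..\<sigma>} \<union> (\<lambda>r. - p r * z r / r) ` {\<sigma>..s} \<union> (\<lambda>r. - z s / (l * r)) ` {s..b})"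
      by (intro bdd bounded_Un[THEN iffD2] conjI) simp
    ultimately have g'_bdd: "bounded (range g')" using bounded_subset by blast
    have g: "piecewise_C1 a b g g'" unfolding piecewise_C1_def
      using g_cont g_deriv g'_bdd g_eq(1,5) g'_eq(1,5) by (auto intro!: exI[of _ "{a, \<sigma>, s, b}"])
    have E1: "((\<lambda>r. r * (g' r)\<^sup>2) has_integral \<epsilon>) {a..\<sigma>}"
    proof (rule has_integral_spike_finite[of "{a, \<sigma>}"])
      have "((\<lambda>r. \<epsilon>\<^sup>2 / r) has_integral \<epsilon>\<^sup>2 * ln \<sigma> - \<epsilon>\<^sup>2 * ln a) {a..\<sigma>}"
        using order by (intro fundamental_theorem_of_calculus)
          (auto simp: has_real_derivative_iff_has_vector_derivative[symmetric] intro!: derivative_eq_intros)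
      then show "((\<lambda>r. \<epsilon>\<^sup>2 / r) has_integral \<epsilon>) {a..\<sigma>}"
        using \<epsilon> by (simp add: ln_a algebra_simps power2_eq_square)
    qed (use order in \<open>auto simp: g'_eq power2_eq_square\<close>)
    have E2: "((\<lambda>r. r * (g' r)\<^sup>2) has_integral I) {\<sigma>..s}"
      by (rule has_integral_spike_finite[of "{\<sigma>, s}", OF _ _ integrable_integral[OF pz_int, folded I_def]])
        (use order in \<open>auto simp: g'_eq power2_eq_square\<close>)
    have E3: "((\<lambda>r. r * (g' r)\<^sup>2) has_integral (z s)\<^sup>2 / l) {s..b}"
    proof (rule has_integral_spike_finite[of "{s, b}"])
      have "((\<lambda>r. (z s)\<^sup>2 / (l\<^sup>2 * r)) has_integral (z s)\<^sup>2 / l\<^sup>2 * ln b - (z s)\<^sup>2 / l\<^sup>2 * ln s) {s..b}"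
        using order l by (intro fundamental_theorem_of_calculus)
          (auto simp: has_real_derivative_iff_has_vector_derivative[symmetric] power4_eq_xxxx power2_eq_square
            intro!: derivative_eq_intros)
      moreover have "(z s)\<^sup>2 / l\<^sup>2 * ln b - (z s)\<^sup>2 / l\<^sup>2 * ln s = (z s)\<^sup>2 / l"
        using l by (simp add: ln_b power2_eq_square field_simps)
      ultimately show "((\<lambda>r. (z s)\<^sup>2 / (l\<^sup>2 * r)) has_integral (z s)\<^sup>2 / l) {s..b}" by simp
    qed (use order l in \<open>auto simp: g'_eq power2_eq_square power4_eq_xxxx\<close>)
    have E: "integral {a..b} (\<lambda>r. r * (g' r)\<^sup>2) = \<epsilon> + I + (z s)\<^sup>2 / l"
      using order by (intro integral_unique has_integral_combine[OF _ _ has_integral_combine[OF _ _ E1 E2] E3]) auto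
    have "integral {\<sigma>..s} (\<lambda>r. w r * (z r)\<^sup>2) = integral {\<sigma>..s} (\<lambda>r. w r * (g r)\<^sup>2)"
      by (intro integral_cong) (auto simp: g_eq)
    also have "\<dots> \<le> integral {a..b} (\<lambda>r. w r * (g r)\<^sup>2)"
      using order \<sigma> w(2)
      by (intro integral_subset_le integrable_continuous_real continuous_intros wc continuous_on_subset[OF g_cont]) auto
    also have "\<dots> \<le> integral {a..b} (\<lambda>r. r * (g' r)\<^sup>2)"
      using H[unfolded log_hardy_def, rule_format, OF _ _ _ g] order \<sigma> by simp
    finally show ?thesis by (simp add: E)
  qed
  \<comment> \<open>The derivative of p * z ^ 2 is at most (w - p ^ 2 / r) * z ^ 2, by the Riccati
    inequality and z' = - p * z / r. Since p vanishes at \<sigma>, integration bounds p s * (z s) ^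
    2 by the integral of w * z ^ 2 minus \<open>I\<close>, and \<open>I\<close> cancels against the
    energy of z in \<open>bound\<close>.\<close>
  have FTC: "((\<lambda>r. p' r * (z r)\<^sup>2 - 2 * ((p r)\<^sup>2 * (z r)\<^sup>2 / r)) has_integral p s * (z s)\<^sup>2 - p \<sigma> * (z \<sigma>)\<^sup>2) {\<sigma>..s}"
  proof (rule fundamental_theorem_of_calculus_interior)
    show "((\<lambda>r. p r * (z r)\<^sup>2) has_vector_derivative p' r * (z r)\<^sup>2 - 2 * ((p r)\<^sup>2 * (z r)\<^sup>2 / r)) (at r)"
      if "r \<in> {\<sigma><..<s}" for r
      unfolding has_real_derivative_iff_has_vector_derivative[symmetric]
      using that p(3)[of r] z[of r] by (auto intro!: derivative_eq_intros simp: power2_eq_square)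
  qed (use \<sigma> in \<open>auto intro!: continuous_intros p z_cont\<close>)
  \<comment> \<open>The Riccati inequality is known only in the open interval. At the two endpoints
    the integrand is replaced by its majorant, so that the comparison is pointwise on the closed
    interval.\<close>
  have 1: "((\<lambda>r. if r \<in> {\<sigma>, s} then w r * (z r)\<^sup>2 - (p r)\<^sup>2 * (z r)\<^sup>2 / r else
      p' r * (z r)\<^sup>2 - 2 * ((p r)\<^sup>2 * (z r)\<^sup>2 / r)) has_integral p s * (z s)\<^sup>2) {\<sigma>..s}"
    by (rule has_integral_spike_finite[of "{\<sigma>, s}", OF _ _ FTC[unfolded p(2) mult_zero_left diff_zero]]) auto
  have 2: "((\<lambda>r. w r * (z r)\<^sup>2 - (p r)\<^sup>2 * (z r)\<^sup>2 / r) has_integral integral {\<sigma>..s} (\<lambda>r. w r * (z r)\<^sup>2) - I) {\<sigma>..s}"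
    unfolding I_def by (intro has_integral_diff integrable_integral wz_int pz_int)
  have "p s * (z s)\<^sup>2 \<le> integral {\<sigma>..s} (\<lambda>r. w r * (z r)\<^sup>2) - I"
  proof (rule has_integral_le[OF 1 2])
    fix r assume r: "r \<in> {\<sigma>..s}"
    show "(if r \<in> {\<sigma>, s} then w r * (z r)\<^sup>2 - (p r)\<^sup>2 * (z r)\<^sup>2 / r else
      p' r * (z r)\<^sup>2 - 2 * ((p r)\<^sup>2 * (z r)\<^sup>2 / r)) \<le> w r * (z r)\<^sup>2 - (p r)\<^sup>2 * (z r)\<^sup>2 / r"
    proof (cases "r \<in> {\<sigma>, s}")
      case False
      then have "p' r * (z r)\<^sup>2 \<le> (w r + (p r)\<^sup>2 / r) * (z r)\<^sup>2"
        using p(4)[of r] r by (intro mult_right_mono) auto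
      then show ?thesis using False by (simp add: algebra_simps)
    qed simp
  qed
  then have "p s * (z s)\<^sup>2 \<le> (z s)\<^sup>2 / l + \<epsilon>" if "0 < \<epsilon>" for \<epsilon> using bound[OF that] by simp
  then have "p s * (z s)\<^sup>2 \<le> (z s)\<^sup>2 / l" by (rule field_le_epsilon)
  then have "p s * (z s)\<^sup>2 \<le> 1 / l * (z s)\<^sup>2" by simp
  then show ?thesis unfolding l_def
    by (rule mult_right_le_imp_le) (use z_pos[of s] in simp)
qed

section \<open>Solution of the Riccati equation\<close>

text \<open>Picard iteration for \<open>p' = w + p\<^sup>2 / r\<close>. The starting point moves to \<open>0\<close> with \<open>k\<close>, so that
  \<open>w\<close> need not be integrable at \<open>0\<close> a priori, and the iteration is still increasing.\<close>

primrec riccati_iter :: "(real \<Rightarrow> real) \<Rightarrow> real \<Rightarrow> nat \<Rightarrow> real \<Rightarrow> real" where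
  "riccati_iter w R 0 = (\<lambda>r. 0)"
| "riccati_iter w R (Suc k) = (\<lambda>r. integral {R / 2 ^ Suc k..r} (\<lambda>t. w t + (riccati_iter w R k t)\<^sup>2 / t))"

lemma integral_antiderivative:
  fixes F :: "real \<Rightarrow> real"
  assumes "continuous_on {0<..<R} F"
  obtains A where "\<And>r. 0 < r \<Longrightarrow> r < R \<Longrightarrow> (A has_real_derivative F r) (at r)"
    "\<And>u v. 0 < u \<Longrightarrow> u \<le> v \<Longrightarrow> v < R \<Longrightarrow> integral {u..v} F = A v - A u"
proof (cases "0 < R")
  case True
  have "isCont F r" if "0 < r" "r < R" for r
    using assms that by (simp add: continuous_on_eq_continuous_at)
  then obtain A where "\<And>r. 0 < r \<Longrightarrow> r < R \<Longrightarrow> (A has_vector_derivative F r) (at r)"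
    using einterval_antiderivative[of "ereal 0" "ereal R" F] True by auto
  then have A: "(A has_real_derivative F r) (at r)" if "0 < r" "r < R" for r
    using that by (simp add: has_real_derivative_iff_has_vector_derivative)
  have "integral {u..v} F = A v - A u" if "0 < u" "u \<le> v" "v < R" for u v
    using that A
    by (intro integral_unique fundamental_theorem_of_calculus)
      (auto simp: has_real_derivative_iff_has_vector_derivative[symmetric] intro: has_field_derivative_at_within)
  with A show ?thesis using that by blast
qed (use that in auto)

context
  fixes w :: "real \<Rightarrow> real" and R :: real
  assumes R: "0 < R" and w_cont: "continuous_on {0<..<R} w"
    and w_nonneg: "\<And>r. 0 < r \<Longrightarrow> r < R \<Longrightarrow> 0 \<le> w r"
begin

lemma riccati_iter_continuous: "continuous_on {0<..<R} (riccati_iter w R k)"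
  and riccati_iter_nonneg: "0 < r \<Longrightarrow> r < R \<Longrightarrow> 0 \<le> riccati_iter w R k r"
  and riccati_iter_deriv: "R / 2 ^ Suc k < r \<Longrightarrow> r < R \<Longrightarrow>
    (riccati_iter w R (Suc k) has_real_derivative w r + (riccati_iter w R k r)\<^sup>2 / r) (at r)"
proof -
  have step: "continuous_on {0<..<R} (riccati_iter w R (Suc k)) \<and>
      (\<forall>r. 0 < r \<longrightarrow> r < R \<longrightarrow> 0 \<le> riccati_iter w R (Suc k) r) \<and>
      (\<forall>r. R / 2 ^ Suc k < r \<longrightarrow> r < R \<longrightarrow>
        (riccati_iter w R (Suc k) has_real_derivative w r + (riccati_iter w R k r)\<^sup>2 / r) (at r))"
    if cont: "continuous_on {0<..<R} (riccati_iter w R k)" for k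
  proof -
    define \<sigma> where "\<sigma> = R / 2 ^ Suc k"
    define F where "F t = w t + (riccati_iter w R k t)\<^sup>2 / t" for t
    define p where "p = riccati_iter w R (Suc k)"
    have \<sigma>: "0 < \<sigma>" "\<sigma> < R" using R by (auto simp: \<sigma>_def field_simps one_less_power power_Suc[symmetric] simp del: power_Suc)
    have F_cont: "continuous_on {0<..<R} F" unfolding F_def[abs_def]
      by (intro continuous_intros w_cont cont) auto
    have F_nonneg: "0 \<le> F r" if "0 < r" "r < R" for r
      using that w_nonneg by (simp add: F_def)
    have p_eq: "p r = integral {\<sigma>..r} F" for r by (simp add: p_def \<sigma>_def F_def[abs_def])
    obtain A where A: "\<And>r. 0 < r \<Longrightarrow> r < R \<Longrightarrow> (A has_real_derivative F r) (at r)"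
      and int: "\<And>u v. 0 < u \<Longrightarrow> u \<le> v \<Longrightarrow> v < R \<Longrightarrow> integral {u..v} F = A v - A u"
      using integral_antiderivative[OF F_cont] by blast
    \<comment> \<open>To the left of \<sigma> the interval of integration is empty and the iterate
      is 0, hence the maximum.\<close>
    have p_A: "p r = A (max \<sigma> r) - A \<sigma>" if "0 < r" "r < R" for r
      using int[of \<sigma> r] \<sigma> that by (cases "\<sigma> \<le> r") (auto simp: p_eq)
    have "isCont A r" if "0 < r" "r < R" for r using A[OF that] by (rule DERIV_isCont)
    then have "continuous_on {0<..<R} A" by (simp add: continuous_at_imp_continuous_on)
    then have "continuous_on {0<..<R} (\<lambda>r. A (max \<sigma> r))"
      by (rule continuous_on_compose2) (use \<sigma> in \<open>auto intro!: continuous_intros\<close>)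
    then have "continuous_on {0<..<R} (\<lambda>r. A (max \<sigma> r) - A \<sigma>)"
      by (intro continuous_on_diff continuous_on_const)
    then have "continuous_on {0<..<R} p" by (rule continuous_on_eq) (simp add: p_A)
    moreover have "0 \<le> p r" if "0 < r" "r < R" for r
    proof -
      have "continuous_on {\<sigma>..r} F" using \<sigma> that by (intro continuous_on_subset[OF F_cont]) auto
      then show ?thesis unfolding p_eq
        using \<sigma> that by (intro integral_nonneg integrable_continuous_real F_nonneg) auto
    qed
    moreover have "(p has_real_derivative F r) (at r)" if "\<sigma> < r" "r < R" for r
    proof (rule has_field_derivative_transform_within_open)
      show "((\<lambda>r. A r - A \<sigma>) has_real_derivative F r) (at r)"
        using A[of r] \<sigma> that by (auto intro!: derivative_eq_intros)
      show "A r - A \<sigma> = p r" if "r \<in> {\<sigma><..<R}" for r using p_A[of r] \<sigma> that by auto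
    qed (use that in auto)
    ultimately show ?thesis unfolding p_def F_def \<sigma>_def by blast
  qed
  have cont: "continuous_on {0<..<R} (riccati_iter w R k)" for k
    by (induction k) (simp, use step in blast)
  then show "continuous_on {0<..<R} (riccati_iter w R k)" .
  show "0 \<le> riccati_iter w R k r" if "0 < r" "r < R"
    using step[OF cont] that by (cases k) auto
  show "(riccati_iter w R (Suc k) has_real_derivative w r + (riccati_iter w R k r)\<^sup>2 / r) (at r)"
    if "R / 2 ^ Suc k < r" "r < R"
    using step[OF cont] that by blast
qed

lemma riccati_iter_rhs:
  "continuous_on {0<..<R} (\<lambda>t. w t + (riccati_iter w R k t)\<^sup>2 / t)"
  "0 < r \<Longrightarrow> r < R \<Longrightarrow> 0 \<le> w r + (riccati_iter w R k r)\<^sup>2 / r"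
  using w_nonneg by (auto intro!: continuous_intros w_cont riccati_iter_continuous add_nonneg_nonneg)

text \<open>The integrand grows by induction, and moving the starting point to the left adds the
  integral of a nonnegative function.\<close>

lemma riccati_iter_mono:
  "0 < r \<Longrightarrow> r < R \<Longrightarrow> riccati_iter w R k r \<le> riccati_iter w R (Suc k) r"
proof (induction k arbitrary: r)
  case 0
  then show ?case using riccati_iter_nonneg[of r 1] by simp
next
  case (Suc k)
  let ?F = "\<lambda>k t. w t + (riccati_iter w R k t)\<^sup>2 / t"
  define \<sigma> \<tau> where "\<sigma> = R / 2 ^ Suc k" and "\<tau> = R / 2 ^ Suc (Suc k)"
  have \<tau>: "0 < \<tau>" "\<tau> \<le> \<sigma>" using R by (auto simp: \<sigma>_def \<tau>_def field_simps)
  have F: "?F j integrable_on {u..r}" if "0 < u" for u j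
    using that Suc.prems by (intro integrable_continuous_real continuous_on_subset[OF riccati_iter_rhs(1)]) auto
  have "integral {\<sigma>..r} (?F k) \<le> integral {\<sigma>..r} (?F (Suc k))"
  proof (intro integral_le F)
    fix t assume "t \<in> {\<sigma>..r}"
    then have t: "0 < t" "t < R" using Suc.prems \<tau> by auto
    show "?F k t \<le> ?F (Suc k) t"
      using t Suc.IH[OF t] riccati_iter_nonneg[OF t] by (intro add_left_mono divide_right_mono power_mono) auto
  qed (use \<tau> in auto)
  also have "\<dots> \<le> integral {\<tau>..r} (?F (Suc k))"
    using \<tau> Suc.prems by (intro integral_subset_le F ballI riccati_iter_rhs(2)) auto
  finally show ?case by (simp add: \<sigma>_def \<tau>_def)
qed

text \<open>An iterate has derivative w + p ^ 2 / r with the previous iterate as p. By monotonicity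
  this is at most the same expression with the iterate itself, so each one is a Riccati subsolution
  starting from 0, and the bound is independent of k.\<close>

lemma riccati_iter_bound:
  assumes H: "log_hardy R w" and r: "0 < r" "r < b" "b < R"
  shows "riccati_iter w R k r \<le> 1 / ln (b / r)"
proof (cases k)
  case 0
  then show ?thesis using r by simp
next
  case (Suc j)
  let ?p = "riccati_iter w R (Suc j)"
  define \<sigma> where "\<sigma> = R / 2 ^ Suc j"
  have \<sigma>: "0 < \<sigma>" using R by (simp add: \<sigma>_def)
  show ?thesis
  proof (cases "r \<le> \<sigma>")
    case True
    then have "?p r = 0" by (cases "r = \<sigma>") (auto simp: \<sigma>_def)
    then show ?thesis using Suc r by simp
  next
    case False
    show ?thesis unfolding Suc
    proof (rule log_hardy_riccati_bound[OF H w_cont w_nonneg \<sigma> _ r(2,3)])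
      show "continuous_on {\<sigma>..r} ?p"
        using \<sigma> r by (intro continuous_on_subset[OF riccati_iter_continuous]) auto
      show "(?p has_real_derivative w t + (riccati_iter w R j t)\<^sup>2 / t) (at t)" if "\<sigma> < t" "t < r" for t
        using that r by (intro riccati_iter_deriv) (auto simp: \<sigma>_def)
      show "w t + (riccati_iter w R j t)\<^sup>2 / t \<le> w t + (?p t)\<^sup>2 / t" if "\<sigma> < t" "t < r" for t
      proof -
        have t: "0 < t" "t < R" using that \<sigma> r by auto
        show ?thesis
          using t riccati_iter_mono[OF t, of j] riccati_iter_nonneg[OF t, of j]
          by (intro add_left_mono divide_right_mono power_mono) auto
      qed
    qed (use False in \<open>auto simp: \<sigma>_def\<close>)
  qed
qed

text \<open>Monotonicity and the uniform bound give a pointwise limit; dominated convergence gives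
  its integral equation on compact subintervals, which are reached once the starting points have
  passed to their left.\<close>

lemma log_hardy_riccati_solution:
  assumes H: "log_hardy R w"
  obtains P where "\<And>r. 0 < r \<Longrightarrow> r < R \<Longrightarrow> (P has_real_derivative w r + (P r)\<^sup>2 / r) (at r)"
proof -
  let ?p = "riccati_iter w R"
  have conv: "convergent (\<lambda>k. ?p k r)" if r: "0 < r" "r < R" for r
  proof -
    have "incseq (\<lambda>k. ?p k r)" using riccati_iter_mono[OF r] by (rule incseq_SucI)
    moreover have "?p k r \<le> 1 / ln (((r + R) / 2) / r)" for k
      using r by (intro riccati_iter_bound[OF H]) auto
    ultimately obtain L where "(\<lambda>k. ?p k r) \<longlonglongrightarrow> L"
      using incseq_convergent[of "\<lambda>k. ?p k r"] by blast
    then show ?thesis by (rule convergentI)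
  qed
  define P where "P r = lim (\<lambda>k. ?p k r)" for r
  have P: "(\<lambda>k. ?p k r) \<longlonglongrightarrow> P r" if "0 < r" "r < R" for r
    unfolding P_def using conv[OF that] by (simp add: convergent_LIMSEQ_iff)
  let ?F = "\<lambda>k t. w t + (?p k t)\<^sup>2 / t" and ?G = "\<lambda>t. w t + (P t)\<^sup>2 / t"
  have *: "?G integrable_on {u..r} \<and> P r = P u + integral {u..r} ?G" if ur: "0 < u" "u \<le> r" "r < R" for u r
  proof -
    \<comment> \<open>The bound with b halfway between r and R increases towards the right, so its
      value at r dominates on all of {u..r}.\<close>
    define B where "B = 1 / ln (((r + R) / 2) / r)"
    have sub: "{u..r} \<subseteq> {0<..<R}" using ur by auto
    have F: "?F k integrable_on {u..r}" for k
      by (intro integrable_continuous_real continuous_on_subset[OF riccati_iter_rhs(1) sub])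
    have h: "(\<lambda>t. w t + B\<^sup>2 / t) integrable_on {u..r}"
      using ur by (intro integrable_continuous_real continuous_intros continuous_on_subset[OF w_cont sub]) auto
    have le: "norm (?F k t) \<le> w t + B\<^sup>2 / t" if "t \<in> {u..r}" for k t
    proof -
      have t: "0 < t" "t < R" "t \<le> r" using that ur by auto
      have "?p k t \<le> 1 / ln (((r + R) / 2) / t)" using t ur by (intro riccati_iter_bound[OF H]) auto
      also have "\<dots> \<le> B"
      proof -
        have "(r + R) / 2 / r \<le> (r + R) / 2 / t" "1 < (r + R) / 2 / r"
          using t ur by (auto intro: divide_left_mono)
        then show ?thesis unfolding B_def by (intro divide_left_mono mult_pos_pos) auto
      qed
      finally have "(?p k t)\<^sup>2 \<le> B\<^sup>2" using riccati_iter_nonneg[OF t(1,2)] by (intro power_mono)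
      then show ?thesis using t riccati_iter_rhs(2)[OF t(1,2), of k] by (simp add: divide_right_mono)
    qed
    have conv: "(\<lambda>k. ?F k t) \<longlonglongrightarrow> ?G t" if "t \<in> {u..r}" for t
      using that ur by (intro tendsto_intros P) auto
    note dct = dominated_convergence[OF F h le conv]
    \<comment> \<open>Once the starting point R / 2 ^ (k + 1) lies to the left of u, the increment
      of the iterate from u to r is the integral over {u..r} alone.\<close>
    have "(\<lambda>k. R * (1 / 2) ^ k) \<longlonglongrightarrow> R * 0" by (intro tendsto_intros LIMSEQ_power_zero) auto
    then have "\<forall>\<^sub>F k in sequentially. R * (1 / 2) ^ k < u" using ur by (intro order_tendstoD) auto
    then have "\<forall>\<^sub>F k in sequentially. ?p (Suc k) r - ?p (Suc k) u = integral {u..r} (?F k)"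
    proof eventually_elim
      case (elim k)
      define \<sigma> where "\<sigma> = R / 2 ^ Suc k"
      have "R * (1 / 2) ^ k = 2 * \<sigma>" by (simp add: \<sigma>_def power_one_over)
      then have \<sigma>: "0 < \<sigma>" "\<sigma> \<le> u" using elim R ur by (auto simp: \<sigma>_def)
      have "?F k integrable_on {\<sigma>..r}"
        using \<sigma> ur by (intro integrable_continuous_real continuous_on_subset[OF riccati_iter_rhs(1)]) auto
      then show ?case using Henstock_Kurzweil_Integration.integral_combine[of \<sigma> u r "?F k"] \<sigma> ur by (simp add: \<sigma>_def[symmetric] del: power_Suc)
    qed
    moreover have "(\<lambda>k. ?p (Suc k) r - ?p (Suc k) u) \<longlonglongrightarrow> P r - P u"
      using ur by (intro tendsto_intros LIMSEQ_Suc P) auto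
    ultimately have "(\<lambda>k. integral {u..r} (?F k)) \<longlonglongrightarrow> P r - P u"
      by (rule Lim_transform_eventually[rotated])
    from LIMSEQ_unique[OF dct(2) this] dct(1) show ?thesis by simp
  qed
  \<comment> \<open>Regularity is bootstrapped: the integral equation makes P continuous, then its
    integrand is continuous, and P is differentiable.\<close>
  have P_cont: "continuous_on {u..v} P" if "0 < u" "v < R" for u v
  proof (cases "u \<le> v")
    case True
    have "continuous_on {u..v} (\<lambda>r. P u + integral {u..r} ?G)"
      by (intro continuous_on_add continuous_on_const indefinite_integral_continuous_1)
        (use *[of u v] True that in blast)
    moreover have "P u + integral {u..r} ?G = P r" if "r \<in> {u..v}" for r
      using *[of u r] that \<open>0 < u\<close> \<open>v < R\<close> by simp
    ultimately show ?thesis by (rule continuous_on_eq)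
  qed simp
  have "(P has_real_derivative w r + (P r)\<^sup>2 / r) (at r)" if r: "0 < r" "r < R" for r
  proof -
    define u v where "u = r / 2" and "v = (r + R) / 2"
    have uv: "0 < u" "u < r" "r < v" "v < R" using r by (auto simp: u_def v_def)
    have "continuous_on {u..v} ?G"
      using uv by (intro continuous_intros P_cont continuous_on_subset[OF w_cont]) auto
    then have "((\<lambda>r. integral {u..r} ?G) has_real_derivative ?G r) (at r within {u..v})"
      using uv by (intro integral_has_real_derivative) auto
    then have D: "((\<lambda>r. P u + integral {u..r} ?G) has_real_derivative ?G r) (at r)"
      using uv by (auto simp: at_within_Icc_at intro!: derivative_eq_intros)
    show ?thesis
    proof (rule has_field_derivative_transform_within_open[OF D])
      show "open {u<..<v}" "r \<in> {u<..<v}" using uv by auto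
      show "P u + integral {u..t} ?G = P t" if "t \<in> {u<..<v}" for t
        using *[of u t] that uv by simp
    qed
  qed
  then show thesis using that by blast
qed

end

text \<open>In terms of P = - r * y' / y the Bessel equation is the Riccati equation with weight c *
  r * W. Recovering y as an exponential makes it positive at once.\<close>

lemma log_hardy_imp_positive_bessel_solution:
  assumes R: "0 < R" and c: "0 \<le> c" and W: "continuous_on {0<..<R} W" "\<And>r. 0 < r \<Longrightarrow> r < R \<Longrightarrow> 0 \<le> W r"
    and H: "log_hardy R (\<lambda>r. c * (r * W r))"
  shows "has_positive_bessel_solution W R c"
proof -
  have "continuous_on {0<..<R} (\<lambda>r. c * (r * W r))" by (intro continuous_intros W)
  then obtain P where P: "\<And>r. 0 < r \<Longrightarrow> r < R \<Longrightarrow> (P has_real_derivative c * (r * W r) + (P r)\<^sup>2 / r) (at r)"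
    using log_hardy_riccati_solution[OF R _ _ H] c W(2) by auto
  have "continuous_on {0<..<R} P" using P by (auto intro!: continuous_at_imp_continuous_on DERIV_isCont)
  then have "continuous_on {0<..<R} (\<lambda>r. P r / r)" by (intro continuous_intros) auto
  then obtain A where A: "\<And>r. 0 < r \<Longrightarrow> r < R \<Longrightarrow> (A has_real_derivative P r / r) (at r)"
    using integral_antiderivative by blast
  define y where "y r = exp (- A r)" for r
  define y' where "y' r = - (P r / r) * y r" for r
  define y'' where "y'' r = - (((c * (r * W r) + (P r)\<^sup>2 / r) * r - P r) / (r * r)) * y r - (P r / r) * y' r" for r
  show ?thesis unfolding has_positive_bessel_solution_def
  proof (intro exI ballI conjI)
    fix r assume "r \<in> {0<..<R}"
    then have r: "0 < r" "r < R" by auto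
    show "0 < y r" by (simp add: y_def)
    show y: "(y has_real_derivative y' r) (at r)"
      using A[OF r] unfolding y_def[abs_def] y'_def by (auto intro!: derivative_eq_intros)
    have "((\<lambda>r. P r / r) has_real_derivative ((c * (r * W r) + (P r)\<^sup>2 / r) * r - P r * 1) / (r * r)) (at r)"
      using r by (intro DERIV_divide P DERIV_ident) auto
    from DERIV_mult[OF DERIV_minus[OF this] y] show "(y' has_real_derivative y'' r) (at r)"
      unfolding y'_def[abs_def] y''_def by (rule DERIV_cong) (simp add: y'_def)
    show "y'' r + 1 / r * y' r + c * W r * y r = 0"
      using r by (simp add: y''_def y'_def field_simps power2_eq_square)
  qed
qed

section \<open>From a positive solution to the Hardy inequality\<close>

lemma integrable_continuous_compact_support:
  fixes G :: "'a::euclidean_space \<Rightarrow> real"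
  assumes "compact C" "continuous_on C G" "\<And>x. x \<notin> C \<Longrightarrow> G x = 0"
  shows "integrable lborel G"
proof -
  have "(\<lambda>x. indicator C x *\<^sub>R G x) = G" 
  proof
    show "indicator C x *\<^sub>R G x = G x" for x by (cases "x \<in> C") (simp_all add: assms(3))
  qed
  then show ?thesis using borel_integrable_compact[OF assms(1,2)] by simp
qed

lemma lborel_integral_dilation:
  fixes G :: "'a::euclidean_space \<Rightarrow> real"
  assumes [measurable]: "G \<in> borel_measurable borel" and t: "0 < t"
  shows "(\<integral>x. G (t *\<^sub>R x) \<partial>lborel) = integral\<^sup>L lborel G / t ^ DIM('a)"
proof -
  have "integral\<^sup>L lborel G = integral\<^sup>L (density (distr lborel borel (\<lambda>x :: 'a. 0 + t *\<^sub>R x)) (\<lambda>_. ennreal (\<bar>t\<bar> ^ DIM('a)))) G"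
    using lborel_affine[of t "0 :: 'a"] t by simp
  also have "\<dots> = (\<integral>x. t ^ DIM('a) * G (t *\<^sub>R x) \<partial>lborel)"
    using t by (subst integral_density) (auto simp: integral_distr)
  finally show ?thesis using t by simp
qed

text \<open>The divergence theorem for the field \<open>G x *\<^sub>R x\<close>, obtained by differentiating
  \<open>\<integral>G (t *\<^sub>R x) = t ^ (- n) * \<integral>G\<close> at \<open>t = 1\<close>.\<close>

lemma integral_radial_divergence:
  fixes G D :: "'a::euclidean_space \<Rightarrow> real"
  assumes C: "compact C" and G: "continuous_on C G" "\<And>x. x \<notin> C \<Longrightarrow> G x = 0"
    and D: "continuous_on C D" "\<And>x. x \<notin> C \<Longrightarrow> D x = 0"
    and deriv: "\<And>x t. 0 < t \<Longrightarrow> ((\<lambda>t. G (t *\<^sub>R x)) has_real_derivative D (t *\<^sub>R x) / t) (at t)"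
  shows "(\<integral>x. real DIM('a) * G x + D x \<partial>lborel) = 0"
proof -
  note intG = integrable_continuous_compact_support[OF C G]
  note intD = integrable_continuous_compact_support[OF C D]
  have meas [measurable]: "G \<in> borel_measurable borel" "D \<in> borel_measurable borel"
    using borel_measurable_integrable[OF intG] borel_measurable_integrable[OF intD] by auto
  obtain \<rho> where "\<forall>x\<in>C. norm x \<le> \<rho>"
    using compact_imp_bounded[OF C] unfolding bounded_iff by blast
  then have \<rho>: "C \<subseteq> cball 0 \<rho>" by auto
  have "bounded (D ` C)" using D(1) C by (intro compact_imp_bounded compact_continuous_image)
  then obtain M where M: "0 < M" "\<And>x. x \<in> C \<Longrightarrow> \<bar>D x\<bar> \<le> M" by (auto simp: bounded_pos)
  have M': "\<bar>D x\<bar> \<le> M" for x using M D(2)[of x] by (cases "x \<in> C") auto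
  \<comment> \<open>Only dilation factors above 1 are used. They shrink the support, so all
    difference quotients vanish outside one ball, which supplies the dominating function.\<close>
  define h where "h j = inverse (real (Suc j))" for j
  have h: "0 < h j" for j by (simp add: h_def)
  have h_lim: "filterlim h (at 0) sequentially"
    using LIMSEQ_inverse_real_of_nat h unfolding h_def[symmetric]
    by (intro filterlim_atI) (auto simp: h_def[abs_def])
  define q where "q j x = (G ((1 + h j) *\<^sub>R x) - G x) / h j" for j x
  have q_meas [measurable]: "q j \<in> borel_measurable borel" for j
    unfolding q_def[abs_def] by measurable
  have q_bd: "norm (q j x) \<le> M * indicator (cball 0 \<rho>) x" for j x
  proof -
    have "\<exists>\<xi>. 1 < \<xi> \<and> \<xi> < 1 + h j \<and> G ((1 + h j) *\<^sub>R x) - G (1 *\<^sub>R x) = (1 + h j - 1) * (D (\<xi> *\<^sub>R x) / \<xi>)"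
      using h[of j] by (intro MVT2 deriv) auto
    then obtain \<xi> where \<xi>: "1 < \<xi>" "q j x = D (\<xi> *\<^sub>R x) / \<xi>"
      using h[of j] by (auto simp: q_def)
    show ?thesis
    proof (cases "x \<in> cball 0 \<rho>")
      case True
      have "\<bar>D (\<xi> *\<^sub>R x)\<bar> / \<xi> \<le> M / 1" using M M'[of "\<xi> *\<^sub>R x"] \<xi> by (intro frac_le) auto
      then show ?thesis using True \<xi> by simp
    next
      case False
      have "1 * norm x \<le> \<xi> * norm x" using \<xi> by (intro mult_right_mono) auto
      then have "\<xi> *\<^sub>R x \<notin> C" using False \<rho> \<xi> by (auto simp: subset_iff)
      then show ?thesis using D(2) \<xi> M by simp
    qed
  qed
  have q_lim: "(\<lambda>j. q j x) \<longlonglongrightarrow> D x" for x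
  proof -
    have "((\<lambda>h. (G ((1 + h) *\<^sub>R x) - G (1 *\<^sub>R x)) / h) \<longlongrightarrow> D (1 *\<^sub>R x) / 1) (at 0)"
      using deriv[of 1 x] unfolding DERIV_def by simp
    from filterlim_compose[OF this h_lim] show ?thesis by (simp add: q_def)
  qed
  have bd_int: "integrable lborel (\<lambda>x :: 'a. M * indicator (cball 0 \<rho>) x)"
    using emeasure_lborel_cball_finite[of "0 :: 'a" \<rho>] by (intro integrable_mult_right) (auto simp: less_top)
  have q_int: "integrable lborel (q j)" for j
    by (rule Bochner_Integration.integrable_bound[OF bd_int]) (use q_bd[of j] M(1) in \<open>auto simp: abs_mult intro!: AE_I2\<close>)
  have lim1: "(\<lambda>j. integral\<^sup>L lborel (q j)) \<longlonglongrightarrow> integral\<^sup>L lborel D"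
    by (rule integral_dominated_convergence[where w = "\<lambda>x. M * indicator (cball 0 \<rho>) x"])
      (use bd_int in \<open>simp_all add: q_lim q_bd del: real_norm_def\<close>)
  have "integral\<^sup>L lborel (q j) = (1 / (1 + h j) ^ DIM('a) - 1 / (1 + 0) ^ DIM('a)) / h j * integral\<^sup>L lborel G" for j
  proof -
    have "integrable lborel (\<lambda>x. G x + h j * q j x)" using intG q_int by simp
    then have i: "integrable lborel (\<lambda>x. G ((1 + h j) *\<^sub>R x))" using h[of j] by (simp add: q_def)
    have "integral\<^sup>L lborel (q j) = ((\<integral>x. G ((1 + h j) *\<^sub>R x) \<partial>lborel) - integral\<^sup>L lborel G) / h j"
      unfolding q_def[abs_def] using i intG by simp
    also have "(\<integral>x. G ((1 + h j) *\<^sub>R x) \<partial>lborel) = integral\<^sup>L lborel G / (1 + h j) ^ DIM('a)"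
      using h[of j] by (intro lborel_integral_dilation meas) simp
    finally show ?thesis by (simp add: diff_divide_distrib left_diff_distrib)
  qed
  moreover have "((\<lambda>t. 1 / t ^ DIM('a)) has_real_derivative - real DIM('a)) (at 1)"
    by (auto intro!: derivative_eq_intros)
  then have "((\<lambda>h. (1 / (1 + h) ^ DIM('a) - 1 / 1 ^ DIM('a)) / h) \<longlongrightarrow> - real DIM('a)) (at 0)"
    unfolding DERIV_def .
  from tendsto_mult_right[OF filterlim_compose[OF this h_lim], of "integral\<^sup>L lborel G"]
  have "(\<lambda>j. (1 / (1 + h j) ^ DIM('a) - 1 / 1 ^ DIM('a)) / h j * integral\<^sup>L lborel G)
      \<longlonglongrightarrow> - real DIM('a) * integral\<^sup>L lborel G" .
  ultimately have "(\<lambda>j. integral\<^sup>L lborel (q j)) \<longlonglongrightarrow> - real DIM('a) * integral\<^sup>L lborel G" by simp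
  from LIMSEQ_unique[OF lim1 this] show ?thesis using intG intD by simp
qed

section \<open>Logarithmic derivative of a positive Bessel solution\<close>

text \<open>With \<open>\<phi> = r powr (- m / 2) * y\<close>, \<open>\<zeta>\<close> is the logarithmic derivative \<open>r * \<phi>' / \<phi>\<close>. It is
  nonpositive because \<open>r * y'\<close> is nonincreasing: a positive value of \<open>r * y'\<close> would force
  \<open>y \<rightarrow> - \<infinity>\<close> at \<open>0\<close>.\<close>

lemma bessel_solution_riccati:
  assumes "has_positive_bessel_solution W R c" "0 \<le> c" "0 \<le> m" and W: "\<And>r. 0 < r \<Longrightarrow> r < R \<Longrightarrow> 0 \<le> W r"
  obtains \<zeta> where "\<And>r. 0 < r \<Longrightarrow> r < R \<Longrightarrow> \<zeta> r \<le> 0"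
    "\<And>r. 0 < r \<Longrightarrow> r < R \<Longrightarrow>
      (\<zeta> has_real_derivative - ((\<zeta> r)\<^sup>2 + m * \<zeta> r + (m / 2)\<^sup>2 + c * r\<^sup>2 * W r) / r) (at r)"
proof -
  obtain y y' y'' where sol: "\<And>r. r \<in> {0<..<R} \<Longrightarrow> 0 < y r \<and> (y has_real_derivative y' r) (at r) \<and>
      (y' has_real_derivative y'' r) (at r) \<and> y'' r + 1 / r * y' r + c * W r * y r = 0"
    using assms(1) unfolding has_positive_bessel_solution_def by blast
  have y_pos: "\<And>r. 0 < r \<Longrightarrow> r < R \<Longrightarrow> 0 < y r"
    and y: "\<And>r. 0 < r \<Longrightarrow> r < R \<Longrightarrow> (y has_real_derivative y' r) (at r)"
    and y': "\<And>r. 0 < r \<Longrightarrow> r < R \<Longrightarrow> (y' has_real_derivative y'' r) (at r)"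
    and ode: "\<And>r. 0 < r \<Longrightarrow> r < R \<Longrightarrow> y'' r + 1 / r * y' r + c * W r * y r = 0"
    using sol by simp_all
  have dec: "y' r \<le> 0" if r: "0 < r" "r < R" for r
  proof (rule ccontr)
    assume "\<not> y' r \<le> 0"
    define L where "L = r * y' r"
    have L: "0 < L" using r \<open>\<not> y' r \<le> 0\<close> by (simp add: L_def)
    \<comment> \<open>By the equation, (x * y')' = x * (y'' + y' / x) = - c * x * W * y <=
      0.\<close>
    have ge: "L \<le> t * y' t" if t: "0 < t" "t \<le> r" for t
      unfolding L_def
    proof (rule DERIV_nonpos_imp_nonincreasing[OF t(2)])
      fix x assume "t \<le> x" "x \<le> r"
      then have x: "0 < x" "x < R" using t r by auto
      have "((\<lambda>x. x * y' x) has_real_derivative 1 * y' x + y'' x * x) (at x)"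
        by (intro DERIV_mult DERIV_ident y' x)
      moreover have "1 * y' x + y'' x * x = - (x * (c * W x * y x))"
        using arg_cong[OF ode[OF x], of "\<lambda>v. x * v"] x by (simp add: algebra_simps)
      moreover have "0 \<le> x * (c * W x * y x)" using x assms(2) W[OF x] y_pos[OF x] by simp
      ultimately show "\<exists>d. ((\<lambda>x. x * y' x) has_real_derivative d) (at x) \<and> d \<le> 0" by auto
    qed
    \<comment> \<open>By \<open>ge\<close>, y - L * ln is nondecreasing up to r, so y t <= y r - L *
      (ln r - ln t). This t makes the right-hand side 0.\<close>
    define t where "t = r * exp (- (y r / L))"
    have t: "0 < t" "t < r" using r L y_pos[OF r] by (auto simp: t_def)
    have "y t - L * ln t \<le> y r - L * ln r"
    proof (rule DERIV_nonneg_imp_nondecreasing[OF less_imp_le[OF t(2)]])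
      fix x assume "t \<le> x" "x \<le> r"
      then have x: "0 < x" "x < R" "x \<le> r" using t r by auto
      have "((\<lambda>x. y x - L * ln x) has_real_derivative y' x - L / x) (at x)"
        using y[OF x(1,2)] x by (auto intro!: derivative_eq_intros)
      moreover have "0 \<le> y' x - L / x" using ge[OF x(1,3)] x by (simp add: field_simps)
      ultimately show "\<exists>d. ((\<lambda>x. y x - L * ln x) has_real_derivative d) (at x) \<and> 0 \<le> d" by blast
    qed
    moreover have "ln t = ln r - y r / L" using r by (simp add: t_def ln_mult)
    ultimately have "y t \<le> 0" using L by (simp add: algebra_simps)
    then show False using y_pos[of t] t r by auto
  qed
  define \<zeta> where "\<zeta> r = - m / 2 + r * y' r / y r" for r
  show thesis
  proof (rule that[of \<zeta>])
    fix r assume r: "0 < r" "r < R"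
    have y0: "0 < y r" by (rule y_pos[OF r])
    have "r * y' r / y r \<le> 0" using dec[OF r] r y0 by (simp add: divide_nonpos_pos mult_nonneg_nonpos)
    then show "\<zeta> r \<le> 0" using assms(3) unfolding \<zeta>_def by linarith
    have "((\<lambda>r. - m / 2 + r * y' r / y r) has_real_derivative
        0 + ((1 * y' r + y'' r * r) * y r - r * y' r * y' r) / (y r * y r)) (at r)"
      using y0 by (intro DERIV_add DERIV_const DERIV_divide DERIV_mult DERIV_ident y y' r) auto
    moreover have "y'' r * r = - y' r - r * (c * W r * y r)"
      using arg_cong[OF ode[OF r], of "\<lambda>v. r * v"] r by (simp add: algebra_simps)
    ultimately have "(\<zeta> has_real_derivative ((1 * y' r + (- y' r - r * (c * W r * y r))) * y r - r * y' r * y' r) / (y r * y r)) (at r)"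
      unfolding \<zeta>_def[abs_def] by simp
    moreover have "((1 * y' r + (- y' r - r * (c * W r * y r))) * y r - r * y' r * y' r) / (y r * y r)
        = - ((\<zeta> r)\<^sup>2 + m * \<zeta> r + (m / 2)\<^sup>2 + c * r\<^sup>2 * W r) / r"
    proof -
      \<comment> \<open>With e = r * y' / y, the shift of \<zeta> by m / 2 turns the first three
        terms of the right-hand side into e ^ 2.\<close>
      define e where "e = r * y' r / y r"
      have e: "y' r = e * y r / r" using r y0 by (simp add: e_def)
      have \<zeta>: "\<zeta> r = e - m / 2" by (simp add: \<zeta>_def e_def)
      have "(\<zeta> r)\<^sup>2 + m * \<zeta> r + (m / 2)\<^sup>2 = e\<^sup>2" unfolding \<zeta> by (simp add: power2_eq_square field_simps)
      moreover have "((1 * y' r + (- y' r - r * (c * W r * y r))) * y r - r * y' r * y' r) / (y r * y r)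
        = - (e\<^sup>2 + c * r\<^sup>2 * W r) / r"
        unfolding e using r y0 by (simp add: field_simps power2_eq_square)
      ultimately show ?thesis by simp
    qed
    ultimately show "(\<zeta> has_real_derivative - ((\<zeta> r)\<^sup>2 + m * \<zeta> r + (m / 2)\<^sup>2 + c * r\<^sup>2 * W r) / r) (at r)" by simp
  qed
qed

section \<open>Test functions on the ball and cutoffs at the origin\<close>

lemma test_function_regularity:
  fixes u :: "real ^ 'n \<Rightarrow> real"
  assumes u: "u \<in> test_functions \<Omega>"
  shows "(u has_derivative (\<lambda>h. grad u x \<bullet> h)) (at x)"
    and "continuous_on UNIV u" and "continuous_on UNIV (grad u)"
proof -
  have C: "C_k k u" for k using u by (simp add: test_functions_def)
  have d: "(u has_derivative frechet_derivative u (at x)) (at x)" for x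
    using C[of 1] by (simp add: differentiable_on_def frechet_derivative_works[symmetric])
  have "frechet_derivative u (at x) h = grad u x \<bullet> h" for x h
  proof -
    have lin: "linear (frechet_derivative u (at x))"
      using d by (rule has_derivative_linear)
    have "frechet_derivative u (at x) h = frechet_derivative u (at x) (\<Sum>i\<in>UNIV. h $ i *\<^sub>R axis i 1)"
      using basis_expansion[of h] by (simp add: scalar_mult_eq_scaleR)
    also have "\<dots> = (\<Sum>i\<in>UNIV. h $ i * frechet_derivative u (at x) (axis i 1))"
      by (simp add: linear_sum[OF lin] linear_cmul[OF lin])
    finally show ?thesis by (simp add: grad_def inner_vec_def mult.commute)
  qed
  with d show D: "(u has_derivative (\<lambda>h. grad u x \<bullet> h)) (at x)" for x by (metis (no_types) ext)
  show "continuous_on UNIV u" using C[of 0] by simp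
  show "continuous_on UNIV (grad u)"
    unfolding grad_def[abs_def] using C[of 1] by (intro continuous_on_vec_lambda) simp
qed

lemma test_function_support:
  fixes u :: "real ^ 'n \<Rightarrow> real"
  assumes u: "u \<in> test_functions (ball 0 R)" and R: "0 < R"
  obtains \<rho> where "0 < \<rho>" "\<rho> < R" "\<And>x. \<rho> < norm x \<Longrightarrow> u x = 0" "\<And>x. \<rho> < norm x \<Longrightarrow> grad u x = 0"
proof -
  \<comment> \<open>The origin is inserted so that the set is nonempty and the norm attains its
    maximum on it.\<close>
  let ?S = "insert 0 (closure {x. u x \<noteq> 0})"
  have S: "compact ?S" "?S \<subseteq> ball 0 R" using u R by (auto simp: test_functions_def)
  obtain x0 where x0: "x0 \<in> ?S" "\<And>x. x \<in> ?S \<Longrightarrow> norm x \<le> norm x0"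
    using continuous_attains_sup[OF S(1), of norm] continuous_on_norm_id by blast
  define \<rho> where "\<rho> = (norm x0 + R) / 2"
  have x0R: "norm x0 < R" using x0(1) S(2) by auto
  have \<rho>: "0 < \<rho>" "\<rho> < R" "norm x0 < \<rho>" using x0R R by (auto simp: \<rho>_def add_nonneg_pos)
  have u0: "u x = 0" if "\<rho> < norm x" for x
  proof (rule ccontr)
    assume "u x \<noteq> 0"
    then have "x \<in> ?S" using closure_subset[of "{x. u x \<noteq> 0}"] by blast
    then show False using x0(2)[of x] that \<rho> by simp
  qed
  have "grad u x = 0" if x: "\<rho> < norm x" for x
  proof -
    have "((\<lambda>_. 0) has_derivative (\<lambda>h. grad u x \<bullet> h)) (at x)"
    proof (rule has_derivative_transform_within_open[OF test_function_regularity(1)[OF u]])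
      show "open {x :: real ^ 'n. \<rho> < norm x}" by (intro open_Collect_less continuous_intros)
    qed (use x u0 in auto)
    then have "(\<lambda>h. grad u x \<bullet> h) = (\<lambda>h. 0)"
      by (rule has_derivative_unique) simp
    from fun_cong[OF this, of "grad u x"] show ?thesis by simp
  qed
  with \<rho> u0 show thesis by (intro that)
qed

text \<open>For r > 0 this vanishes up to 1 / (j + 1) and is nondecreasing in both r and j. The
  square of the positive part makes it C1. Monotonicity in r gives the sign of the term at the
  origin, monotonicity in j the passage to the limit.\<close>

definition cutoff :: "nat \<Rightarrow> real \<Rightarrow> real" where
  "cutoff j r = (max 0 (1 - 1 / (real (Suc j) * r)))\<^sup>2"

lemma cutoff_has_derivative:
  assumes "0 < r"
  shows "(cutoff j has_real_derivative 2 * max 0 (1 - 1 / (real (Suc j) * r)) * (1 / (real (Suc j) * r\<^sup>2))) (at r)"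
proof -
  have sq: "((\<lambda>s. (max 0 s)\<^sup>2) has_real_derivative 2 * max 0 s) (at s)" for s :: real
  proof (cases s "0::real" rule: linorder_cases)
    case less
    have "((\<lambda>_. 0) has_real_derivative 0) (at s)" by simp
    then have "((\<lambda>s. (max 0 s)\<^sup>2) has_real_derivative 0) (at s)"
      by (rule has_field_derivative_transform_within_open[of _ _ _ "{..<0}"]) (use less in auto)
    then show ?thesis using less by simp
  next
    case equal
    have "((\<lambda>h::real. max 0 h) \<longlongrightarrow> 0) (at 0)"
      by (rule tendsto_eq_rhs[OF tendsto_max[OF tendsto_const tendsto_ident_at]]) simp
    then have "((\<lambda>h::real. (max 0 h)\<^sup>2 / h) \<longlongrightarrow> 0) (at 0)"
      by (rule Lim_transform_eventually)
        (auto simp: eventually_at_filter power2_eq_square max_def)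
    then show ?thesis using equal by (simp add: DERIV_def)
  next
    case greater
    have "((\<lambda>s. s\<^sup>2) has_real_derivative 2 * s) (at s)" by (auto intro!: derivative_eq_intros)
    then have "((\<lambda>s. (max 0 s)\<^sup>2) has_real_derivative 2 * s) (at s)"
      by (rule has_field_derivative_transform_within_open[of _ _ _ "{0<..}"]) (use greater in auto)
    then show ?thesis using greater by simp
  qed
  have "((\<lambda>r. 1 - 1 / (\<kappa> * r)) has_real_derivative 1 / (\<kappa> * r\<^sup>2)) (at r)" if "0 < \<kappa>" for \<kappa>
    using assms that by (auto intro!: derivative_eq_intros simp: power2_eq_square field_simps)
  from DERIV_chain2[OF sq this[of "real (Suc j)"]] show ?thesis
    unfolding cutoff_def[abs_def] by simp
qed

lemma cutoff_mono: "0 < r \<Longrightarrow> i \<le> j \<Longrightarrow> cutoff i r \<le> cutoff j r"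
  unfolding cutoff_def by (intro power_mono max.mono diff_left_mono divide_left_mono mult_right_mono) auto

lemma cutoff_bounds: "0 \<le> cutoff j r" "0 < r \<Longrightarrow> cutoff j r \<le> 1"
  by (auto simp: cutoff_def intro!: power_le_one)

lemma cutoff_tendsto: "0 < r \<Longrightarrow> (\<lambda>j. cutoff j r) \<longlonglongrightarrow> 1"
proof -
  assume r: "0 < r"
  have "(\<lambda>j. (max 0 (1 - inverse (real (Suc j)) * (1 / r)))\<^sup>2) \<longlonglongrightarrow> (max 0 (1 - 0 * (1 / r)))\<^sup>2"
    by (intro tendsto_intros LIMSEQ_inverse_real_of_nat)
  then show ?thesis by (simp add: cutoff_def divide_inverse)
qed

text \<open>The cutoff confines the divergence argument to an annulus. The term at the origin then
  appears as r * \<theta>' * \<zeta> * u ^ 2, nonpositive because \<theta>' >= 0 and \<zeta> <= 0.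
  On the gradient side the cutoff is at most 1 and is dropped at the end.\<close>

lemma cutoff_hardy:
  fixes u :: "real ^ 'n \<Rightarrow> real" and a :: real
  defines "n \<equiv> real CARD('n)"
  defines "m \<equiv> n - 2 * a - 2"
  assumes u: "u \<in> test_functions (ball 0 R)" and R: "0 < R" and m: "0 \<le> m" and c: "0 \<le> c"
    and W: "continuous_on {0<..<R} W" "\<And>r. 0 < r \<Longrightarrow> r < R \<Longrightarrow> 0 \<le> W r"
    and sol: "has_positive_bessel_solution W R c"
  shows "(\<integral>\<^sup>+x\<in>ball 0 R. ennreal (cutoff j (norm x) * ((m / 2)\<^sup>2 * (norm x powr (- 2 * a - 2) * (u x)\<^sup>2) +
        c * (norm x powr (- 2 * a) * W (norm x) * (u x)\<^sup>2))) \<partial>lborel)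
      \<le> (\<integral>\<^sup>+x\<in>ball 0 R. ennreal (norm x powr (- 2 * a) * (norm (grad u x))\<^sup>2) \<partial>lborel)"
proof -
  obtain \<zeta> where \<zeta>: "\<And>r. 0 < r \<Longrightarrow> r < R \<Longrightarrow> \<zeta> r \<le> 0"
    "\<And>r. 0 < r \<Longrightarrow> r < R \<Longrightarrow>
      (\<zeta> has_real_derivative - ((\<zeta> r)\<^sup>2 + m * \<zeta> r + (m / 2)\<^sup>2 + c * r\<^sup>2 * W r) / r) (at r)"
    using bessel_solution_riccati[OF sol c m W(2)] by blast
  obtain \<rho> where \<rho>: "0 < \<rho>" "\<rho> < R" and u0: "\<And>x. \<rho> < norm x \<Longrightarrow> u x = 0" "\<And>x. \<rho> < norm x \<Longrightarrow> grad u x = 0"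
    using test_function_support[OF u R] by blast
  note du = test_function_regularity[OF u]
  define \<kappa> where "\<kappa> = real (Suc j)"
  have \<kappa>: "0 < \<kappa>" by (simp add: \<kappa>_def)
  define \<theta> where "\<theta> = cutoff j"
  define \<theta>' where "\<theta>' r = 2 * max 0 (1 - 1 / (\<kappa> * r)) * (1 / (\<kappa> * r\<^sup>2))" for r
  have \<theta>: "(\<theta> has_real_derivative \<theta>' r) (at r)" if "0 < r" for r
    using cutoff_has_derivative[OF that] by (simp add: \<theta>_def \<theta>'_def \<kappa>_def)
  have \<theta>'_nonneg: "0 \<le> \<theta>' r" if "0 < r" for r using \<kappa> that by (simp add: \<theta>'_def)
  have \<theta>_nonneg: "0 \<le> \<theta> r" for r by (simp add: \<theta>_def cutoff_bounds)
  have \<theta>_0: "\<theta> r = 0" "\<theta>' r = 0" if "0 < r" "r < 1 / \<kappa>" for r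
  proof -
    have "max 0 (1 - 1 / (\<kappa> * r)) = 0" using that \<kappa> by (simp add: field_simps)
    then show "\<theta> r = 0" "\<theta>' r = 0" by (simp_all add: \<theta>_def \<theta>'_def cutoff_def \<kappa>_def)
  qed
  define F where "F r = \<theta> r * r powr (- 2 * a - 2) * \<zeta> r" for r
  \<comment> \<open>This is r * F'. The equation for \<zeta> contributes m and the power of r
    contributes 2a + 2 to the coefficient of \<zeta>; their sum is n, so the linear term cancels in
    n * G + D and a square can be completed.\<close>
  define E where "E r = r powr (- 2 * a - 2) * (r * \<theta>' r * \<zeta> r
      - \<theta> r * ((\<zeta> r)\<^sup>2 + n * \<zeta> r + (m / 2)\<^sup>2 + c * r\<^sup>2 * W r))" for r
  have F: "(F has_real_derivative E r / r) (at r)" if r: "0 < r" "r < R" for r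
  proof -
    have "((\<lambda>r. r powr (- 2 * a - 2)) has_real_derivative (- 2 * a - 2) * r powr (- 2 * a - 2) / r) (at r)"
      using DERIV_powr[OF DERIV_ident r(1) DERIV_const[of "- 2 * a - 2"]] r by (simp add: field_simps)
    from DERIV_mult[OF DERIV_mult[OF \<theta>[OF r(1)] this] \<zeta>(2)[OF r]]
    show ?thesis unfolding F_def[abs_def]
      by (rule DERIV_cong) (use r in \<open>simp add: E_def m_def field_simps\<close>)
  qed
  define G where "G x = F (norm x) * (u x)\<^sup>2" for x
  define D where "D x = E (norm x) * (u x)\<^sup>2 + F (norm x) * (2 * u x * (grad u x \<bullet> x))" for x
  let ?C = "{x :: real ^ 'n. 1 / \<kappa> \<le> norm x \<and> norm x \<le> \<rho>}"
  have C: "compact ?C"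
  proof -
    have "closed ?C" by (intro closed_Collect_conj closed_Collect_le continuous_intros)
    moreover have "bounded ?C" by (rule boundedI[of _ \<rho>]) auto
    ultimately show ?thesis by (simp add: compact_eq_bounded_closed)
  qed
  have C_range: "0 < norm x \<and> norm x < R" if "x \<in> ?C" for x
    using that \<kappa> \<rho> less_le_trans[of 0 "1 / \<kappa>" "norm x"] by auto
  have out: "F (norm x) = 0 \<and> E (norm x) = 0 \<or> u x = 0 \<and> grad u x = 0" if "x \<notin> ?C" for x
  proof (cases "x = 0")
    case False
    then show ?thesis using that \<theta>_0[of "norm x"] u0[of x] by (auto simp: F_def E_def not_le)
  qed (simp add: F_def E_def)
  have \<zeta>_cont: "continuous_on {0<..<R} \<zeta>" and \<theta>_cont: "continuous_on {0<..<R} \<theta>"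
    using DERIV_isCont[OF \<zeta>(2)] DERIV_isCont[OF \<theta>] by (auto intro!: continuous_at_imp_continuous_on)
  have \<theta>'_cont: "continuous_on {0<..<R} \<theta>'"
    unfolding \<theta>'_def[abs_def] using \<kappa> by (intro continuous_intros) auto
  have norm_comp: "continuous_on ?C (\<lambda>x. f (norm x))" if "continuous_on {0<..<R} f" for f :: "real \<Rightarrow> real"
    by (rule continuous_on_compose2[OF that]) (use C_range in \<open>auto intro: continuous_intros\<close>)
  have u_cont: "continuous_on ?C u" "continuous_on ?C (grad u)"
    using du(2,3) by (auto intro: continuous_on_subset)
  have F_cont: "continuous_on ?C (\<lambda>x. F (norm x))"
    unfolding F_def by (rule norm_comp) (auto intro!: continuous_intros \<zeta>_cont \<theta>_cont)
  have E_cont: "continuous_on ?C (\<lambda>x. E (norm x))"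
    unfolding E_def by (rule norm_comp) (auto intro!: continuous_intros \<zeta>_cont \<theta>_cont \<theta>'_cont W)
  have G_cont: "continuous_on ?C G" unfolding G_def[abs_def]
    by (intro continuous_intros F_cont u_cont)
  have D_cont: "continuous_on ?C D" unfolding D_def[abs_def]
    by (intro continuous_intros F_cont E_cont u_cont)
  have G0: "G x = 0" and D0: "D x = 0" if "x \<notin> ?C" for x using out[OF that] by (auto simp: G_def D_def)
  have deriv: "((\<lambda>t. G (t *\<^sub>R x)) has_real_derivative D (t *\<^sub>R x) / t) (at t)" if t: "0 < t" for x t
  proof (cases "norm (t *\<^sub>R x) < R \<and> x \<noteq> 0")
    case True
    have norm: "norm (t *\<^sub>R x) = t * norm x" using t by simp
    have pos: "0 < t * norm x" "t * norm x < R" using True t by auto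
    have "((\<lambda>t. t * norm x) has_real_derivative norm x) (at t)" by (auto intro!: derivative_eq_intros)
    from DERIV_chain2[OF F[OF pos] this]
    have 1: "((\<lambda>t. F (t * norm x)) has_real_derivative E (t * norm x) / t) (at t)"
      using pos True by (simp add: field_simps)
    have "((\<lambda>t. t *\<^sub>R x) has_derivative (\<lambda>h. h *\<^sub>R x)) (at t)" by (auto intro!: derivative_eq_intros)
    from has_derivative_compose[OF this du(1)]
    have "((\<lambda>t. u (t *\<^sub>R x)) has_derivative (\<lambda>h. grad u (t *\<^sub>R x) \<bullet> (h *\<^sub>R x))) (at t)" .
    then have 2: "((\<lambda>t. u (t *\<^sub>R x)) has_real_derivative grad u (t *\<^sub>R x) \<bullet> x) (at t)"
      unfolding has_field_derivative_def
      by (rule has_derivative_eq_rhs) (simp add: fun_eq_iff mult.commute)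
    have 3: "((\<lambda>t. F (t * norm x) * (u (t *\<^sub>R x))\<^sup>2) has_real_derivative D (t *\<^sub>R x) / t) (at t)"
      by (rule DERIV_cong[OF DERIV_mult[OF 1 DERIV_power[OF 2, of 2]]])
        (use t norm in \<open>simp add: D_def field_simps\<close>)
    show ?thesis
      by (rule has_field_derivative_transform_within_open[OF 3, of "{0<..}"]) (use t in \<open>auto simp: G_def\<close>)
  next
    case False
    show ?thesis
    proof (cases "x = 0")
      case True
      then show ?thesis using G0[of 0] D0[of 0] \<kappa> by simp
    next
      case x: False
      \<comment> \<open>\<open>F\<close> is controlled only below R; from here on G vanishes because
        u does.\<close>
      then have "\<rho> < norm (t *\<^sub>R x)" using False \<rho> by auto
      then have "D (t *\<^sub>R x) = 0" by (intro D0) auto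
      moreover have "((\<lambda>_. 0) has_real_derivative 0) (at t)" by simp
      then have "((\<lambda>t. G (t *\<^sub>R x)) has_real_derivative 0) (at t)"
      proof (rule has_field_derivative_transform_within_open)
        show "open {t. \<rho> < norm (t *\<^sub>R x)}" by (intro open_Collect_less continuous_intros)
        show "0 = G (s *\<^sub>R x)" if "s \<in> {t. \<rho> < norm (t *\<^sub>R x)}" for s
          by (rule G0[symmetric]) (use that in auto)
      qed (use \<open>\<rho> < norm (t *\<^sub>R x)\<close> in simp)
      ultimately show ?thesis by simp
    qed
  qed
  have div: "(\<integral>x. n * G x + D x \<partial>lborel) = 0"
    using integral_radial_divergence[OF C G_cont G0 D_cont D0 deriv] by (simp add: n_def)
  define P where "P x = \<theta> (norm x) * ((m / 2)\<^sup>2 * (norm x powr (- 2 * a - 2) * (u x)\<^sup>2) +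
        c * (norm x powr (- 2 * a) * W (norm x) * (u x)\<^sup>2))" for x
  define Q where "Q x = \<theta> (norm x) * (norm x powr (- 2 * a) * (norm (grad u x))\<^sup>2)" for x
  have PQ_out: "P x = 0 \<and> Q x = 0" if "x \<notin> ?C" for x
  proof (cases "x = 0")
    case False
    then show ?thesis using that \<theta>_0[of "norm x"] u0[of x] by (auto simp: P_def Q_def not_le)
  qed (simp add: P_def Q_def)
  have W_cont: "continuous_on ?C (\<lambda>x. W (norm x))" by (rule norm_comp[OF W(1)])
  have \<theta>_cont': "continuous_on ?C (\<lambda>x. \<theta> (norm x))" by (rule norm_comp[OF \<theta>_cont])
  have nz: "\<And>x. x \<in> ?C \<Longrightarrow> norm x \<noteq> 0" using C_range by force
  have P_cont: "continuous_on ?C P" unfolding P_def[abs_def]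
    by (intro continuous_intros W_cont \<theta>_cont' u_cont) (use nz in auto)
  have Q_cont: "continuous_on ?C Q" unfolding Q_def[abs_def]
    by (intro continuous_intros \<theta>_cont' u_cont) (use nz in auto)
  have int: "integrable lborel G" "integrable lborel D" "integrable lborel P" "integrable lborel Q"
    using G0 D0 PQ_out
    by (auto intro: integrable_continuous_compact_support[OF C G_cont] integrable_continuous_compact_support[OF C D_cont]
      integrable_continuous_compact_support[OF C P_cont] integrable_continuous_compact_support[OF C Q_cont])
  have le: "n * G x + D x \<le> Q x - P x" for x
  proof (cases "x \<in> ?C")
    case True
    define r where "r = norm x"
    define w where "w = r powr (- 2 * a - 2)"
    define d where "d = grad u x \<bullet> x"
    have r: "0 < r" "r < R" using C_range[OF True] by (auto simp: r_def)
    have w: "0 < w" using r by (simp add: w_def)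
    have w2: "r powr (- 2 * a) = w * r\<^sup>2"
      using r by (simp add: w_def powr_diff powr_numeral[symmetric] del: powr_numeral)
    have GD: "n * G x + D x = w * (r * \<theta>' r * \<zeta> r * (u x)\<^sup>2) +
      w * \<theta> r * (2 * \<zeta> r * u x * d - (\<zeta> r)\<^sup>2 * (u x)\<^sup>2 - (m / 2)\<^sup>2 * (u x)\<^sup>2 - c * r\<^sup>2 * W r * (u x)\<^sup>2)"
      unfolding G_def D_def F_def E_def r_def[symmetric] w_def[symmetric] d_def[symmetric] by (simp add: algebra_simps)
    have "w * (r * \<theta>' r * \<zeta> r * (u x)\<^sup>2) \<le> 0"
      using r w \<zeta>(1)[OF r] \<theta>'_nonneg[OF r(1)] by (simp add: mult_nonneg_nonpos mult_nonpos_nonneg)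
    moreover have "2 * \<zeta> r * u x * d - (\<zeta> r)\<^sup>2 * (u x)\<^sup>2 \<le> d\<^sup>2"
      using zero_le_power2[of "\<zeta> r * u x - d"] by (simp add: power2_eq_square algebra_simps)
    moreover have "d\<^sup>2 \<le> r\<^sup>2 * (norm (grad u x))\<^sup>2"
      using Cauchy_Schwarz_ineq[of "grad u x" x] by (simp add: d_def r_def power2_norm_eq_inner mult.commute)
    ultimately have "w * (r * \<theta>' r * \<zeta> r * (u x)\<^sup>2) \<le> 0"
      "2 * \<zeta> r * u x * d - (\<zeta> r)\<^sup>2 * (u x)\<^sup>2 - (m / 2)\<^sup>2 * (u x)\<^sup>2 - c * r\<^sup>2 * W r * (u x)\<^sup>2 \<le>
        r\<^sup>2 * (norm (grad u x))\<^sup>2 - (m / 2)\<^sup>2 * (u x)\<^sup>2 - c * r\<^sup>2 * W r * (u x)\<^sup>2"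
      by auto
    from add_mono[OF this(1) mult_left_mono[OF this(2), of "w * \<theta> r"]]
    have "n * G x + D x \<le> w * \<theta> r * (r\<^sup>2 * (norm (grad u x))\<^sup>2 - (m / 2)\<^sup>2 * (u x)\<^sup>2 - c * r\<^sup>2 * W r * (u x)\<^sup>2)"
      unfolding GD using w \<theta>_nonneg[of r] by simp
    then show ?thesis
      unfolding P_def Q_def r_def[symmetric] w2 w_def[symmetric] by (simp add: algebra_simps)
  qed (use PQ_out G0 D0 in simp)
  have "(\<integral>x. n * G x + D x \<partial>lborel) \<le> (\<integral>x. Q x - P x \<partial>lborel)"
    using int le by (intro integral_mono) auto
  then have PQ: "integral\<^sup>L lborel P \<le> integral\<^sup>L lborel Q" using div int by simp
  have nonneg: "0 \<le> P x" "0 \<le> Q x" for x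
  proof -
    show "0 \<le> Q x" using \<theta>_nonneg by (simp add: Q_def)
    show "0 \<le> P x"
    proof (cases "x \<in> ?C")
      case True
      then show ?thesis using C_range[OF True] W(2)[of "norm x"] c \<theta>_nonneg by (simp add: P_def)
    qed (use PQ_out in simp)
  qed
  have "(\<integral>\<^sup>+x\<in>ball 0 R. ennreal (P x) \<partial>lborel) \<le> (\<integral>\<^sup>+x. ennreal (P x) \<partial>lborel)"
    by (intro nn_integral_mono) (simp add: indicator_def)
  also have "\<dots> = ennreal (integral\<^sup>L lborel P)" using int nonneg by (simp add: nn_integral_eq_integral)
  also have "\<dots> \<le> ennreal (integral\<^sup>L lborel Q)" using PQ by (rule ennreal_leI)
  also have "\<dots> = (\<integral>\<^sup>+x. ennreal (Q x) \<partial>lborel)" using int nonneg by (simp add: nn_integral_eq_integral)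
  also have "\<dots> \<le> (\<integral>\<^sup>+x\<in>ball 0 R. ennreal (norm x powr (- 2 * a) * (norm (grad u x))\<^sup>2) \<partial>lborel)"
  proof (intro nn_integral_mono)
    fix x :: "real ^ 'n"
    show "ennreal (Q x) \<le> ennreal (norm x powr (- 2 * a) * (norm (grad u x))\<^sup>2) * indicator (ball 0 R) x"
    proof (cases "x \<in> ?C")
      case True
      have "Q x \<le> 1 * (norm x powr (- 2 * a) * (norm (grad u x))\<^sup>2)"
        unfolding Q_def \<theta>_def using C_range[OF True] cutoff_bounds(2)[of "norm x" j]
        by (intro mult_right_mono) auto
      moreover have "x \<in> ball 0 R" using C_range[OF True] by simp
      ultimately show ?thesis by (simp add: ennreal_leI)
    qed (use PQ_out in simp)
  qed
  finally show ?thesis by (simp add: P_def \<theta>_def)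
qed

text \<open>The cutoffs increase to 1, so monotone convergence in [0, \<infinity>] removes them
  without any prior integrability at the origin. If the left-hand side is finite, so are the
  weighted terms on the right.\<close>

lemma positive_bessel_solution_imp_hardy_inequality:
  fixes a :: real
  defines "n \<equiv> real CARD('n::finite)"
  defines "K \<equiv> ((n - 2 * a - 2) / 2)\<^sup>2"
  assumes R: "0 < R" and a: "a \<le> (n - 2) / 2" and c: "0 \<le> c"
    and W: "continuous_on {0<..<R} W" "\<And>r. 0 < r \<Longrightarrow> r < R \<Longrightarrow> 0 \<le> W r"
    and sol: "has_positive_bessel_solution W R c"
  shows "hardy_inequality (ball (0 :: real ^ 'n) R) a K c (\<lambda>x. norm x powr (- 2 * a) * W (norm x))"
  unfolding hardy_inequality_def
proof
  fix u :: "real ^ 'n \<Rightarrow> real" assume u: "u \<in> test_functions (ball 0 R)"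
  let ?B = "ball (0 :: real ^ 'n) R"
  define f where "f x = norm x powr (- 2 * a - 2) * (u x)\<^sup>2" for x
  define v where "v x = norm x powr (- 2 * a) * W (norm x) * (u x)\<^sup>2" for x
  let ?I = "\<integral>\<^sup>+x\<in>?B. ennreal (norm x powr (- 2 * a) * (norm (grad u x))\<^sup>2) \<partial>lborel"
  have [measurable]: "?B \<in> sets borel" by simp
  have [measurable]: "u \<in> borel_measurable borel"
    using test_function_regularity(2)[OF u] by (rule borel_measurable_continuous_onI)
  have [measurable]: "(\<lambda>r. indicator {0<..<R} r * W r) \<in> borel_measurable borel"
    using borel_measurable_continuous_on_indicator[OF _ W(1)] by simp
  \<comment> \<open>\<open>W\<close> is arbitrary outside (0, R), so measurability is obtained for
    its truncation. At the origin both sides vanish because \<open>0 powr _ = 0\<close>.\<close>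
  have v_eq: "ennreal (v x) * indicator ?B x =
      ennreal (norm x powr (- 2 * a) * (indicator {0<..<R} (norm x) * W (norm x)) * (u x)\<^sup>2)" for x
    by (auto simp: v_def indicator_def)
  have f_meas: "(\<lambda>x. ennreal (f x) * indicator ?B x) \<in> borel_measurable lborel"
    unfolding f_def by measurable
  have v_meas: "(\<lambda>x. ennreal (v x) * indicator ?B x) \<in> borel_measurable lborel"
    unfolding v_eq by measurable
  let ?g = "\<lambda>j x. ennreal (cutoff j (norm x) * (K * f x + c * v x)) * indicator ?B x"
  let ?h = "\<lambda>x. ennreal K * (ennreal (f x) * indicator ?B x) + ennreal c * (ennreal (v x) * indicator ?B x)"
  have K: "0 \<le> K" by (simp add: K_def)
  have fv_nonneg: "0 \<le> f x" "x \<in> ?B \<Longrightarrow> 0 \<le> v x" for x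
    using W(2)[of "norm x"] by (cases "x = 0"; simp add: f_def v_def)+
  have g_eq: "?g j x = ennreal (cutoff j (norm x)) * ?h x" for j x
  proof (cases "x \<in> ?B")
    case True
    then show ?thesis using K c fv_nonneg[of x] cutoff_bounds(1)[of j "norm x"]
      by (simp add: ennreal_mult)
  qed simp
  have cutoff_meas [measurable]: "cutoff j \<in> borel_measurable borel" for j
    unfolding cutoff_def[abs_def] by measurable
  have h_meas: "?h \<in> borel_measurable lborel"
    using f_meas v_meas by measurable
  \<comment> \<open>The monotonicity and the limit of the cutoffs are stated for r > 0; at the
    origin the integrand itself is 0.\<close>
  have h_0: "?h 0 = 0" by (simp add: f_def v_def)
  have lim: "(\<lambda>j. \<integral>\<^sup>+x. ?g j x \<partial>lborel) \<longlonglongrightarrow> (\<integral>\<^sup>+x. ?h x \<partial>lborel)"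
  proof (rule nn_integral_LIMSEQ)
    show "incseq ?g"
    proof (intro incseq_SucI le_funI)
      fix j and x :: "real ^ 'n"
      show "?g j x \<le> ?g (Suc j) x"
      proof (cases "x = 0")
        case True
        show ?thesis by (simp only: g_eq True h_0 mult_zero_right order_refl)
      next
        case False
        then have "cutoff j (norm x) \<le> cutoff (Suc j) (norm x)" by (intro cutoff_mono) auto
        then show ?thesis unfolding g_eq by (intro mult_right_mono ennreal_leI) auto
      qed
    qed
    show "?g j \<in> borel_measurable lborel" for j
      unfolding g_eq using h_meas by measurable
    show "(\<lambda>j. ?g j x) \<longlonglongrightarrow> ?h x" for x
    proof (cases "x = 0")
      case True
      show ?thesis by (simp only: g_eq True h_0 mult_zero_right tendsto_const)
    next
      case False
      then have "(\<lambda>j. ennreal (cutoff j (norm x)) * ?h x) \<longlonglongrightarrow> ennreal 1 * ?h x"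
        by (intro tendsto_intros tendsto_ennrealI cutoff_tendsto) auto
      then show ?thesis unfolding g_eq by simp
    qed
  qed
  have "(\<integral>\<^sup>+x. ?g j x \<partial>lborel) \<le> ?I" for j
    using cutoff_hardy[OF u R _ c W sol, of a j] a by (simp add: f_def v_def K_def n_def)
  then have "(\<integral>\<^sup>+x. ?h x \<partial>lborel) \<le> ?I" by (intro LIMSEQ_le_const2[OF lim]) auto
  moreover have "(\<integral>\<^sup>+x. ?h x \<partial>lborel) =
      ennreal K * (\<integral>\<^sup>+x\<in>?B. ennreal (f x) \<partial>lborel) + ennreal c * (\<integral>\<^sup>+x\<in>?B. ennreal (v x) \<partial>lborel)"
    using f_meas v_meas by (simp add: nn_integral_add nn_integral_cmult)
  ultimately show "ennreal K * (\<integral>\<^sup>+x\<in>?B. ennreal (norm x powr (- 2 * a - 2) * (u x)\<^sup>2) \<partial>lborel) +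
      ennreal c * (\<integral>\<^sup>+x\<in>?B. ennreal (norm x powr (- 2 * a) * W (norm x) * (u x)\<^sup>2) \<partial>lborel) \<le> ?I"
    by (simp add: f_def v_def)
qed

section \<open>Best constant and nonexistence on the whole space\<close>

lemma log_hardy_cong:
  assumes "\<And>r. 0 < r \<Longrightarrow> r < R \<Longrightarrow> w r = w' r"
  shows "log_hardy R w \<longleftrightarrow> log_hardy R w'"
proof -
  have "integral {\<alpha>..\<beta>} (\<lambda>r. w r * (g r)\<^sup>2) = integral {\<alpha>..\<beta>} (\<lambda>r. w' r * (g r)\<^sup>2)"
    if "0 < \<alpha>" "\<beta> < R" for \<alpha> \<beta> g
    using that by (intro integral_cong) (simp add: assms)
  then show ?thesis unfolding log_hardy_def by simp
qed

text \<open>The integral of w from \<sigma> is a Riccati subsolution, since p ^ 2 / r >= 0. The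
  bound does not depend on \<sigma>, so it also controls w near the origin.\<close>

lemma log_hardy_integral_bound:
  assumes H: "log_hardy R w" and w: "continuous_on {0<..<R} w" "\<And>r. 0 < r \<Longrightarrow> r < R \<Longrightarrow> 0 \<le> w r"
    and \<sigma>: "0 < \<sigma>" "\<sigma> < s" "s < b" "b < R"
  shows "integral {\<sigma>..s} w \<le> 1 / ln (b / s)"
proof -
  have w_cont: "continuous_on {\<sigma>..s} w" using \<sigma> by (intro continuous_on_subset[OF w(1)]) auto
  show ?thesis
  proof (rule log_hardy_riccati_bound[OF H w \<sigma>, of "\<lambda>r. integral {\<sigma>..r} w" w])
    show "continuous_on {\<sigma>..s} (\<lambda>r. integral {\<sigma>..r} w)"
      by (intro indefinite_integral_continuous_1 integrable_continuous_real w_cont)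
    show "((\<lambda>r. integral {\<sigma>..r} w) has_real_derivative w r) (at r)" if "\<sigma> < r" "r < s" for r
      using integral_has_real_derivative[OF w_cont, of r] that by (simp add: at_within_Icc_at)
    show "w r \<le> w r + (integral {\<sigma>..r} w)\<^sup>2 / r" if "\<sigma> < r" "r < s" for r
      using that \<sigma> by simp
  qed auto
qed

lemma hardy_inequality_constant_le:
  fixes a :: real and \<Omega> :: "(real ^ 'n) set"
  defines "K \<equiv> ((real CARD('n) - 2 * a - 2) / 2)\<^sup>2"
  assumes H: "hardy_inequality \<Omega> a k c V" and R: "0 < R" and c: "0 \<le> c"
    and a: "a \<le> (real CARD('n) - 2) / 2"
    and V: "\<And>x :: real ^ 'n. 0 < norm x \<Longrightarrow> norm x < R \<Longrightarrow> x \<in> \<Omega> \<and> V x = v (norm x)"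
    and v: "continuous_on {0<..<R} v" "\<And>r. 0 < r \<Longrightarrow> r < R \<Longrightarrow> 0 \<le> v r"
  shows "k \<le> K"
proof (rule ccontr)
  assume "\<not> k \<le> K"
  define e where "e = k - K"
  have e: "0 < e" using \<open>\<not> k \<le> K\<close> by (simp add: e_def)
  have k: "0 \<le> k" using e zero_le_power2[of "(real CARD('n) - 2 * a - 2) / 2"] unfolding e_def K_def by linarith
  define w where "w r = e / r + c * (r powr (1 + 2 * a) * v r)" for r
  have H': "log_hardy R w"
    using hardy_inequality_imp_log_hardy[OF H k c a V v] unfolding w_def[abs_def] e_def K_def by simp
  have w_cont: "continuous_on {0<..<R} w"
    unfolding w_def[abs_def] by (intro continuous_intros v) auto
  have w_ge: "e / r \<le> w r" if "0 < r" "r < R" for r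
    using c v(2)[OF that] by (simp add: w_def)
  have w_nonneg: "0 \<le> w r" if "0 < r" "r < R" for r
    using w_ge[OF that] e that by (meson divide_nonneg_pos less_imp_le order_trans)
  define b s where "b = R / 2" and "s = R / 4"
  define L where "L = 1 / ln (b / s)"
  have bs: "0 < s" "s < b" "b < R" using R by (auto simp: b_def s_def)
  have L: "0 < L" using bs by (simp add: L_def)
  \<comment> \<open>The integral of e / r over {\<sigma>..s} is then L + 1, while the bound for the
    weight stays at L for every \<sigma>.\<close>
  define \<sigma> where "\<sigma> = s * exp (- ((L + 1) / e))"
  have \<sigma>: "0 < \<sigma>" "\<sigma> < s" using bs L e by (auto simp: \<sigma>_def)
  have int: "((\<lambda>r. e / r) has_integral e * ln s - e * ln \<sigma>) {\<sigma>..s}"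
    using \<sigma> by (intro fundamental_theorem_of_calculus)
      (auto simp: has_real_derivative_iff_has_vector_derivative[symmetric] intro!: derivative_eq_intros)
  have "e * ln s - e * ln \<sigma> = L + 1"
    using bs e by (simp add: \<sigma>_def ln_mult field_simps)
  then have "L + 1 = integral {\<sigma>..s} (\<lambda>r. e / r)" using int by (simp add: integral_unique)
  also have "\<dots> \<le> integral {\<sigma>..s} w"
    using \<sigma> bs by (intro integral_le w_ge has_integral_integrable[OF int] integrable_continuous_real
      continuous_on_subset[OF w_cont]) auto
  also have "\<dots> \<le> L"
    unfolding L_def by (rule log_hardy_integral_bound[OF H' w_cont w_nonneg \<sigma> bs(2,3)])
  finally show False by simp
qed

lemma no_global_log_hardy:
  assumes H: "\<And>R. log_hardy R w" and w: "continuous_on {0<..} w" "\<And>r. 0 < r \<Longrightarrow> 0 < w r"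
  shows False
proof -
  have cont: "continuous_on S w" if "S \<subseteq> {0<..}" for S using w(1) that by (rule continuous_on_subset)
  have "continuous_on {1..2} w" by (rule cont) auto
  then obtain r0 where r0: "r0 \<in> {1..2}" "\<And>r. r \<in> {1..2} \<Longrightarrow> w r0 \<le> w r"
    using continuous_attains_inf[of "{1..2 :: real}" w] by auto
  define J where "J = w r0"
  have J: "0 < J" using w(2) r0(1) by (simp add: J_def)
  have "J = integral {1..2} (\<lambda>_::real. J)" by simp
  also have "\<dots> \<le> integral {1..2} w"
    using r0(2) by (intro integral_le integrable_continuous_real cont) (auto simp: J_def)
  finally have J_le: "J \<le> integral {1..2} w" .
  \<comment> \<open>The weight has integral at least J over {1..2}, and b may be as large as
    desired. This choice gives ln (b / 2) = 1 / J + 1, so the bound 1 / ln (b / 2) falls below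
    J.\<close>
  define b where "b = 2 * exp (1 / J + 1)"
  have b: "2 < b" using J by (simp add: b_def add_pos_pos)
  have "integral {1..2} w \<le> 1 / ln (b / 2)"
    using b w(2) by (intro log_hardy_integral_bound[OF H[of "b + 1"]] cont) (auto simp: less_imp_le)
  also have "ln (b / 2) = 1 / J + 1" by (simp add: b_def)
  also have "1 / (1 / J + 1) < 1 / (1 / J)"
  proof -
    have "0 < 1 / J" using J by simp
    then show ?thesis by (intro divide_strict_left_mono mult_pos_pos; linarith)
  qed
  finally show False using J_le J by simp
qed

theorem theorem2p15:
  fixes a R :: real and W :: "real \<Rightarrow> real"
  defines "n \<equiv> real CARD('n::finite)"
  defines "K \<equiv> ((n - 2 * a - 2) / 2)\<^sup>2"
  defines "B \<equiv> ball (0 :: real ^ 'n) R"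
  defines "V \<equiv> (\<lambda>x :: real ^ 'n. norm x powr (- 2 * a) * W (norm x))"
  assumes "0 < R"
    and "a \<le> (n - 2) / 2"
    and "W C1_differentiable_on {0<..<R}"
    and "\<forall>r\<in>{0<..<R}. 0 < W r"
  shows "(bessel_potential W R \<longleftrightarrow> (\<exists>c>0. hardy_inequality B a K c V)) \<and>
    (\<forall>c>0. hardy_inequality B a K c V \<longrightarrow>
      best_constant (\<lambda>k. hardy_inequality B a k c V) K) \<and>
    (bessel_potential W R \<longrightarrow>
      bessel_weight W R = Sup (ereal ` {c. 0 < c \<and> hardy_inequality B a K c V})) \<and>
    \<not> (\<exists>(U :: real \<Rightarrow> real) c.
      U C1_differentiable_on {0<..} \<and> (\<forall>r>0. 0 < U r) \<and> 0 < c \<and>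
      hardy_inequality (UNIV :: (real ^ 'n) set) a K c (\<lambda>x. U (norm x)))"
proof -
  note R = \<open>0 < R\<close> and a = \<open>a \<le> (n - 2) / 2\<close>
  have W_cont: "continuous_on {0<..<R} W"
    using assms(7) by (rule C1_differentiable_imp_continuous_on)
  have W_nonneg: "0 \<le> W r" if "0 < r" "r < R" for r using assms(8) that by (simp add: less_imp_le)
  have K: "0 \<le> K" by (simp add: K_def)
  let ?v = "\<lambda>r. r powr (- 2 * a) * W r"
  have v: "continuous_on {0<..<R} ?v" "\<And>r. 0 < r \<Longrightarrow> r < R \<Longrightarrow> 0 \<le> ?v r"
    by (intro continuous_intros W_cont) (auto simp: W_nonneg)
  have V: "x \<in> B \<and> V x = ?v (norm x)" if "0 < norm x" "norm x < R" for x
    using that by (simp add: B_def V_def)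
  \<comment> \<open>Both directions keep c, so this settles the equivalence of the two statements
    and the equality of the suprema at once.\<close>
  have core: "has_positive_bessel_solution W R c \<longleftrightarrow> hardy_inequality B a K c V" if c: "0 < c" for c
  proof
    assume "has_positive_bessel_solution W R c"
    then show "hardy_inequality B a K c V"
      unfolding B_def V_def K_def n_def
      using R a c W_cont W_nonneg by (intro positive_bessel_solution_imp_hardy_inequality) (auto simp: n_def)
  next
    assume "hardy_inequality B a K c V"
    from hardy_inequality_imp_log_hardy[OF this K less_imp_le[OF c] a[unfolded n_def] V v]
    have "log_hardy R (\<lambda>r. (K - K) / r + c * (r powr (1 + 2 * a) * ?v r))"
      unfolding K_def n_def by simp
    \<comment> \<open>The exponents 1 + 2a from the reduction and - 2a from the potential leave r,
      which is the weight of the Bessel equation.\<close>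
    also have "?this \<longleftrightarrow> log_hardy R (\<lambda>r. c * (r * W r))"
      by (rule log_hardy_cong) (simp add: mult.assoc[symmetric] powr_add[symmetric])
    finally show "has_positive_bessel_solution W R c"
      using R c W_cont W_nonneg by (intro log_hardy_imp_positive_bessel_solution) auto
  qed
  have 1: "bessel_potential W R \<longleftrightarrow> (\<exists>c>0. hardy_inequality B a K c V)"
    unfolding bessel_potential_def using assms(7) W_nonneg core by auto
  have 2: "best_constant (\<lambda>k. hardy_inequality B a k c V) K" if "0 < c" "hardy_inequality B a K c V" for c
    unfolding best_constant_def
  proof (intro conjI allI impI notI)
    fix k assume "K < k" "hardy_inequality B a k c V"
    from hardy_inequality_constant_le[OF this(2) R less_imp_le[OF \<open>0 < c\<close>] a[unfolded n_def] V v] this(1)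
    show False by (simp add: K_def n_def)
  qed (rule that)
  have 3: "bessel_weight W R = Sup (ereal ` {c. 0 < c \<and> hardy_inequality B a K c V})"
  proof -
    have "{c. 0 < c \<and> has_positive_bessel_solution W R c} = {c. 0 < c \<and> hardy_inequality B a K c V}"
      using core by blast
    then show ?thesis by (simp only: bessel_weight_def)
  qed
  have False if U: "U C1_differentiable_on {0<..}" "\<forall>r>0. 0 < U r" "0 < c"
      "hardy_inequality (UNIV :: (real ^ 'n) set) a K c (\<lambda>x. U (norm x))" for U :: "real \<Rightarrow> real" and c
  proof (rule no_global_log_hardy)
    have U_cont: "continuous_on {0<..} U" using U(1) by (rule C1_differentiable_imp_continuous_on)
    \<comment> \<open>On the whole space the reduction applies with every radius R', and
      \<open>U\<close> carries no factor |x| powr (- 2a), so the power r powr (1 + 2a)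
      remains.\<close>
    show "log_hardy R' (\<lambda>r. c * (r powr (1 + 2 * a) * U r))" for R'
    proof -
      have "continuous_on {0<..<R'} U" by (rule continuous_on_subset[OF U_cont]) auto
      then show ?thesis
        using hardy_inequality_imp_log_hardy[OF U(4) K less_imp_le[OF U(3)] a[unfolded n_def], of R' U] U(2)
        by (simp add: K_def n_def less_imp_le)
    qed
    show "continuous_on {0<..} (\<lambda>r. c * (r powr (1 + 2 * a) * U r))"
      by (intro continuous_intros U_cont) auto
    show "0 < c * (r powr (1 + 2 * a) * U r)" if "0 < r" for r using U that by simp
  qed
  with 1 2 3 show ?thesis by blast
qed

end
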